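(* For every nonempty open set $\mathcal{U} \subseteq \mathcal{P}$ there is a constant $c_3 = c_3(\mathcal{U}) > 0$ such that for every sequence $(\beta_n)_{n \in \mathbb{N}}$ of positive numbers with $\lim_{n \to \infty} n^{-1/3} \beta_n = \infty$ and for every sequence of estimators $\hat{a}_n : \Omega^n \to \mathbb{R}$, $n \in \mathbb{N}$, one has $$\sup_{P \in \mathcal{U}} \limsup_{n \to \infty} P^n\big[L_P(\hat{a}_n) > L_P(a(P)) + c_3 \beta_n^{-2}\big] \geq 1/4.$$
   Context: Let $\Omega = [0,1] \times \{\pm 1\}$ with the Borel $\sigma$-field. Let $\tilde{\mathcal{P}}$ be the set of all probability measures $P$ on $\Omega$ having a density $f_P \in C^1([0,1]\times\{\pm 1\})$ with respect to (Lebesgue measure on $[0,1]$) $\otimes$ (counting measure on $\{\pm1\}$). Write $f_P^+ := f_P(\cdot,1)$ and $f_P^- := f_P(\cdot,-1)$. Endow $\tilde{\mathcal{P}}$ with the metric $d(P,Q) := \|f_P - f_Q\|_\infty + \|\partial_1 f_P - \partial_1 f_Q\|_\infty$, where $\partial_1$ is the derivative with respect to the first argument. Let $\mathcal{P} \subseteq \tilde{\mathcal{P}}$ be the set of all $P \in \tilde{\mathcal{P}}$ such that there is a unique point $a(P) \in [0,1]$ with $f_P^+(a(P)) = f_P^-(a(P))$, this point lies in the open interval $(0,1)$, and $(f_P^+)'(a(P)) > (f_P^-)'(a(P))$. $\mathcal{P}$ carries the topology induced by $d$; "open" means open in $\mathcal{P}$. $P^n$ denotes the $n$-fold product measure of $P$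 on $\Omega^n$. An estimator is a measurable function $\hat a_n:\Omega^n \to \mathbb{R}$. For $\alpha \in \mathbb{R}$ let $h_\alpha(x) := 1$ if $x \geq \alpha$ and $h_\alpha(x) := -1$ if $x < \alpha$. The prediction error is $L_P(\alpha) := P[h_\alpha(X) \neq Y]$, where $(X,Y)$ is the identity (coordinate pair) on $\Omega$, distributed according to $P$. $L_P(\hat a_n)$ denotes the composition of the function $L_P$ with $\hat a_n$. *)

theory Defs
  imports "HOL-Probability.Probability"
begin

definition Omega :: "(real \<times> int) set"
  where "Omega = {0..1} \<times> {-1, 1}"

definition base_measure :: "(real \<times> int) measure"
  where "base_measure = restrict_space lborel {0..1} \<Otimes>\<^sub>M count_space {-1, 1}"

text \<open>The derivative is taken within \<open>{0..1}\<close>, so it is one-sided at the endpoints; only the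
  values of \<open>f\<close> on \<open>Omega\<close> matter.\<close>

definition partial1 :: "(real \<times> int \<Rightarrow> real) \<Rightarrow> real \<times> int \<Rightarrow> real"
  where "partial1 f = (\<lambda>(x, y). vector_derivative (\<lambda>t. f (t, y)) (at x within {0..1}))"

definition C1_Omega :: "(real \<times> int \<Rightarrow> real) \<Rightarrow> bool"
  where "C1_Omega f \<longleftrightarrow>
    (\<forall>y\<in>{-1, 1}. (\<forall>x\<in>{0..1}. (\<lambda>t. f (t, y)) differentiable (at x within {0..1})) \<and>
      continuous_on {0..1} (\<lambda>x. partial1 f (x, y)))"

definition is_C1_density :: "(real \<times> int) measure \<Rightarrow> (real \<times> int \<Rightarrow> real) \<Rightarrow> bool"
  where "is_C1_density P f \<longleftrightarrow>
    C1_Omega f \<and> (\<forall>\<omega>\<in>Omega. 0 \<le> f \<omega>) \<and> P = density base_measure (\<lambda>\<omega>. ennreal (f \<omega>))"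

definition P_tilde :: "(real \<times> int) measure set"
  where "P_tilde = {P. prob_space P \<and> (\<exists>f. is_C1_density P f)}"

text \<open>\<open>dens P\<close> is determined on \<open>Omega\<close> only (see \<open>dens_unique\<close> below). The value outside
  \<open>P_tilde\<close> is a dummy that makes \<open>dist_P\<close> nonnegative and symmetric on the whole type, as
  \<^locale>\<open>Metric_space\<close> demands.\<close>

definition dens :: "(real \<times> int) measure \<Rightarrow> real \<times> int \<Rightarrow> real"
  where "dens P = (if P \<in> P_tilde then (SOME f. is_C1_density P f) else (\<lambda>_. 0))"

definition sup_norm :: "(real \<times> int \<Rightarrow> real) \<Rightarrow> real"
  where "sup_norm g = (SUP \<omega>\<in>Omega. \<bar>g \<omega>\<bar>)"

definition dist_P :: "(real \<times> int) measure \<Rightarrow> (real \<times> int) measure \<Rightarrow> real"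
  where "dist_P P Q =
    sup_norm (\<lambda>\<omega>. dens P \<omega> - dens Q \<omega>) +
    sup_norm (\<lambda>\<omega>. partial1 (dens P) \<omega> - partial1 (dens Q) \<omega>)"

definition is_crossing :: "(real \<times> int) measure \<Rightarrow> real \<Rightarrow> bool"
  where "is_crossing P a \<longleftrightarrow> a \<in> {0..1} \<and> dens P (a, 1) = dens P (a, -1)"

definition crossing :: "(real \<times> int) measure \<Rightarrow> real"
  where "crossing P = (THE a. is_crossing P a)"

definition P_class :: "(real \<times> int) measure set"
  where "P_class = {P \<in> P_tilde. (\<exists>!a. is_crossing P a) \<and> crossing P \<in> {0<..<1} \<and>
    partial1 (dens P) (crossing P, 1) > partial1 (dens P) (crossing P, -1)}"

definition P_topology :: "(real \<times> int) measure topology"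
  where "P_topology = subtopology (Metric_space.mtopology P_tilde dist_P) P_class"

definition estimator :: "nat \<Rightarrow> ((nat \<Rightarrow> real \<times> int) \<Rightarrow> real) \<Rightarrow> bool"
  where "estimator n a \<longleftrightarrow> a \<in> borel_measurable (PiM {..<n} (\<lambda>_. base_measure))"

definition threshold_classifier :: "real \<Rightarrow> real \<Rightarrow> int"
  where "threshold_classifier \<alpha> x = (if x \<ge> \<alpha> then 1 else -1)"

definition prediction_error :: "(real \<times> int) measure \<Rightarrow> real \<Rightarrow> real"
  where "prediction_error P \<alpha> =
    measure P {\<omega> \<in> space P. threshold_classifier \<alpha> (fst \<omega>) \<noteq> snd \<omega>}"

lemma space_base_measure: "space base_measure = Omega"
  by (simp add: base_measure_def Omega_def space_pair_measure space_restrict_space)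

lemma C1_Omega_deriv:
  assumes "C1_Omega f" "x \<in> {0..1}" "y \<in> {-1, 1}"
  shows "((\<lambda>t. f (t, y)) has_vector_derivative partial1 f (x, y)) (at x within {0..1})"
  using assms unfolding C1_Omega_def partial1_def
  by (auto simp: vector_derivative_works[symmetric])

lemma C1_Omega_cont:
  assumes "C1_Omega f" "y \<in> {-1, 1}"
  shows "continuous_on {0..1} (\<lambda>t. f (t, y))"
  using C1_Omega_deriv[OF assms(1) _ assms(2)]
  unfolding continuous_on_eq_continuous_within
  by (blast intro: has_vector_derivative_continuous)

lemma bdd_above_Omega:
  assumes "\<And>y. y \<in> {-1, 1} \<Longrightarrow> continuous_on {0..1} (\<lambda>x. g (x, y))"
  shows "bdd_above ((\<lambda>\<omega>. \<bar>g \<omega> :: real\<bar>) ` Omega)"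
proof -
  have b: "bdd_above ((\<lambda>x. \<bar>g (x, y)\<bar>) ` {0..1})" if "y \<in> {-1, 1}" for y
    by (intro bounded_imp_bdd_above compact_imp_bounded compact_continuous_image
        continuous_on_rabs assms that) auto
  have "(\<lambda>\<omega>. \<bar>g \<omega>\<bar>) ` Omega = (\<Union>y\<in>{-1, 1}. (\<lambda>x. \<bar>g (x, y)\<bar>) ` {0..1})"
    by (auto simp: Omega_def image_iff)
  then show ?thesis
    using b[of 1] b[of "-1"] by simp
qed

lemma is_C1_density_dens: "P \<in> P_tilde \<Longrightarrow> is_C1_density P (dens P)"
  unfolding P_tilde_def dens_def by (auto intro: someI[of "is_C1_density P"])

lemma C1_dens: "C1_Omega (dens P)"
proof (cases "P \<in> P_tilde")
  case True
  then show ?thesis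
    by (blast dest: is_C1_density_dens[unfolded is_C1_density_def])
next
  case False
  have "vector_derivative (\<lambda>t. 0::real) (at x within {0..1}) = 0" if "x \<in> {0..1}" for x :: real
    using vector_derivative_within_closed_interval[of 0 1 x "\<lambda>t. 0::real" 0] that by simp
  then have "continuous_on {0..1} (\<lambda>x::real. vector_derivative (\<lambda>t. 0::real) (at x within {0..1}))"
    by (subst continuous_on_cong[OF refl, where g = "\<lambda>_. 0"]) auto
  with False show ?thesis
    by (simp add: dens_def C1_Omega_def partial1_def)
qed

lemma Metric_space_P_tilde: "Metric_space P_tilde dist_P"
proof -
  have bd: "bdd_above ((\<lambda>\<omega>. \<bar>dens P \<omega> - dens Q \<omega>\<bar>) ` Omega)" for P Q
    by (intro bdd_above_Omega continuous_intros C1_Omega_cont C1_dens)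
  have bd': "bdd_above ((\<lambda>\<omega>. \<bar>partial1 (dens P) \<omega> - partial1 (dens Q) \<omega>\<bar>) ` Omega)" for P Q
    using C1_dens by (intro bdd_above_Omega continuous_intros) (auto simp: C1_Omega_def)
  have ne: "(0, 1) \<in> Omega"
    by (simp add: Omega_def)
  have nn: "0 \<le> sup_norm g" if "bdd_above ((\<lambda>\<omega>. \<bar>g \<omega>\<bar>) ` Omega)" for g
    unfolding sup_norm_def by (rule cSUP_upper2[OF that ne]) simp
  have tri: "sup_norm (\<lambda>\<omega>. g \<omega> - k \<omega>) \<le> sup_norm (\<lambda>\<omega>. g \<omega> - h \<omega>) + sup_norm (\<lambda>\<omega>. h \<omega> - k \<omega>)"
    if "bdd_above ((\<lambda>\<omega>. \<bar>g \<omega> - h \<omega>\<bar>) ` Omega)" "bdd_above ((\<lambda>\<omega>. \<bar>h \<omega> - k \<omega>\<bar>) ` Omega)"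
    for g h k
    unfolding sup_norm_def
  proof (rule cSUP_least)
    show "Omega \<noteq> {}" using ne by auto
    fix \<omega> assume w: "\<omega> \<in> Omega"
    have "\<bar>g \<omega> - k \<omega>\<bar> \<le> \<bar>g \<omega> - h \<omega>\<bar> + \<bar>h \<omega> - k \<omega>\<bar>" by simp
    also have "\<dots> \<le> (SUP \<omega>\<in>Omega. \<bar>g \<omega> - h \<omega>\<bar>) + (SUP \<omega>\<in>Omega. \<bar>h \<omega> - k \<omega>\<bar>)"
      by (intro add_mono cSUP_upper w that)
    finally show "\<bar>g \<omega> - k \<omega>\<bar> \<le> (SUP \<omega>\<in>Omega. \<bar>g \<omega> - h \<omega>\<bar>) + (SUP \<omega>\<in>Omega. \<bar>h \<omega> - k \<omega>\<bar>)" .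
  qed
  have "dist_P P Q = dist_P Q P" for P Q
    by (simp add: dist_P_def sup_norm_def abs_minus_commute)
  moreover have "P = Q" if "P \<in> P_tilde" "Q \<in> P_tilde" "dist_P P Q = 0" for P Q
  proof -
    have "sup_norm (\<lambda>\<omega>. dens P \<omega> - dens Q \<omega>) = 0"
      using that(3) nn[OF bd[of P Q]] nn[OF bd'[of P Q]] by (simp add: dist_P_def)
    then have eq: "dens P \<omega> = dens Q \<omega>" if "\<omega> \<in> Omega" for \<omega>
      using cSUP_upper[OF that bd[of P Q]] by (simp add: sup_norm_def)
    have "density base_measure (\<lambda>\<omega>. ennreal (dens P \<omega>)) = density base_measure (\<lambda>\<omega>. ennreal (dens Q \<omega>))"
    proof -
      have "(\<lambda>A. \<integral>\<^sup>+ x. ennreal (dens P x) * indicator A x \<partial>base_measure) =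
            (\<lambda>A. \<integral>\<^sup>+ x. ennreal (dens Q x) * indicator A x \<partial>base_measure)"
        by (intro ext nn_integral_cong) (simp add: space_base_measure eq)
      then show ?thesis
        by (simp add: density_def)
    qed
    then show ?thesis
      using that(1,2)[THEN is_C1_density_dens] by (simp add: is_C1_density_def)
  qed
  moreover have "dist_P P P = 0" for P
  proof -
    have "Omega \<noteq> {}" using ne by blast
    then show ?thesis by (simp add: dist_P_def sup_norm_def)
  qed
  moreover have "0 \<le> dist_P P Q" for P Q
    using nn[OF bd[of P Q]] nn[OF bd'[of P Q]] by (simp add: dist_P_def)
  moreover have "dist_P P R \<le> dist_P P Q + dist_P Q R" for P Q R
    using tri[OF bd[of P Q] bd[of Q R]] tri[OF bd'[of P Q] bd'[of Q R]]
    by (simp add: dist_P_def)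
  ultimately show ?thesis
    by unfold_locales blast+
qed

lemma borel_measurable_C1_Omega:
  assumes "C1_Omega f"
  shows "f \<in> borel_measurable base_measure"
proof -
  have m: "(\<lambda>x. f (x, y)) \<in> borel_measurable (restrict_space lborel {0..1})" if "y \<in> {-1, 1}" for y
    using borel_measurable_continuous_on_restrict[OF C1_Omega_cont[OF assms that]]
    by (simp add: measurable_def space_restrict_space sets_restrict_space)
  show ?thesis
    unfolding base_measure_def
    by (subst measurable_pair_swap_iff) (rule measurable_pair_measure_countable1, use m in auto)
qed

lemma dens_unique:
  assumes "is_C1_density P f" "is_C1_density P g" "\<omega> \<in> Omega"
  shows "f \<omega> = g \<omega>"
proof -
  interpret L: sigma_finite_measure "restrict_space lborel {0..1::real}"
    by (intro sigma_finite_measure_restrict_space sigma_finite_lborel) auto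
  interpret C: sigma_finite_measure "count_space {-1, 1::int}"
    by (intro sigma_finite_measure_count_space_finite) auto
  interpret LC: pair_sigma_finite "restrict_space lborel {0..1::real}" "count_space {-1, 1::int}" ..
  obtain x y where w: "\<omega> = (x, y)" "x \<in> {0..1}" "y \<in> {-1, 1}"
    using assms(3) by (auto simp: Omega_def)
  have C1: "C1_Omega f" "C1_Omega g"
    using assms by (auto simp: is_C1_density_def)
  have "density base_measure (\<lambda>\<omega>. ennreal (f \<omega>)) = density base_measure (\<lambda>\<omega>. ennreal (g \<omega>))"
    using assms by (simp add: is_C1_density_def)
  then have "AE \<omega> in base_measure. ennreal (f \<omega>) = ennreal (g \<omega>)"
    by (intro LC.P.density_unique[folded base_measure_def] measurable_compose[OF _ measurable_ennreal]
        borel_measurable_C1_Omega C1)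
  then have "AE \<omega> in base_measure. f \<omega> = g \<omega>"
    using AE_space[of base_measure]
    by eventually_elim (use assms in \<open>auto simp: is_C1_density_def space_base_measure\<close>)
  from LC.AE_pair[OF this[unfolded base_measure_def]]
  have "AE x in restrict_space lborel {0..1}. f (x, y) = g (x, y)"
    by eventually_elim (use w in \<open>auto simp: AE_count_space\<close>)
  then have ae: "AE x in lborel. x \<in> {0..1} \<longrightarrow> f (x, y) = g (x, y)"
    by (subst (asm) AE_restrict_space_iff) auto
  define k where "k t = f (max 0 (min 1 t), y) - g (max 0 (min 1 t), y)" for t
  have "continuous_on {0..1} (\<lambda>t. f (t, y) - g (t, y))"
    by (intro continuous_intros C1_Omega_cont C1 w)
  then have kc: "continuous_on UNIV k"
    unfolding k_def
    by (rule continuous_on_compose2[where g="\<lambda>t. f (t, y) - g (t, y)"])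
       (auto intro!: continuous_intros)
  have "closed {t. k t = 0}"
    by (intro closed_Collect_eq kc continuous_intros)
  moreover have "AE t \<in> {0<..<1} in lebesgue. t \<in> {t. k t = 0}"
    using AE_completion[OF ae] by eventually_elim (auto simp: k_def min_def max_def)
  ultimately have sub: "{0<..<1} \<subseteq> {t. k t = 0}"
    using mem_closed_if_AE_lebesgue_open[of "{0<..<1}" "{t. k t = 0}"] by auto
  have "{0..1} \<subseteq> {t. k t = 0}"
    using closure_minimal[OF sub \<open>closed {t. k t = 0}\<close>] by simp
  then have "k x = 0" using w by auto
  then show ?thesis using w by (simp add: k_def)
qed

end

theory Submission
  imports Defs
begin

text \<open>
  Fix \<open>P\<close> in the open set with density \<open>f\<close>. Near the crossing both branches of \<open>f\<close> are positive
  (otherwise both derivatives would vanish there) and the difference of the branches has positive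
  slope. Adding \<open>y \<psi>(x)\<close> to \<open>f (x, y)\<close>, where \<open>\<psi>\<close> is \<open>C\<^sup>1\<close>-small and supported near the crossing,
  keeps the measure in the open set. These \<open>\<psi>\<close>, represented by their derivatives, form a closed
  subset of a Banach space.

  A bump of height about \<open>\<tau> w\<close> and width \<open>w\<close> centred at the current crossing moves the crossing by
  at least a constant times \<open>w\<close>, while the chi-square distance of the two measures is of order
  \<open>w\<^sup>3\<close>. For \<open>w\<close> proportional to \<open>1 / \<beta>\<^sub>n\<close> the \<open>n\<close>-fold products become indistinguishable, so
  at one of the two measures the estimator has excess error above \<open>2 / \<beta>\<^sub>n\<^sup>2\<close> with probability at
  least \<open>3/8\<close>; for fixed \<open>n\<close> this survives small changes of \<open>\<psi>\<close>, with \<open>1 / \<beta>\<^sub>n\<^sup>2\<close> and \<open>1/4\<close>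
  instead. Hence, for each \<open>N\<close>, failure at some \<open>n \<ge> N\<close> holds on a dense open set of perturbations,
  and by the Baire category theorem a single perturbation fails for infinitely many \<open>n\<close>. The constant
  \<open>c3 = 1\<close> works for every open set, since \<open>w \<beta>\<^sub>n\<close> may be chosen as large as necessary.
\<close>

subsection \<open>Chi-square bound for product measures\<close>

text \<open>A product measure is determined by its values on boxes, and over a box the integral of
  the product of ratios factorises into one-dimensional integrals. \<open>Q\<close> supplies the
  sigma-finiteness that this uniqueness demands.\<close>

lemma PiM_density:
  fixes R :: "'a \<Rightarrow> real"
  assumes P: "prob_space P" and Q: "prob_space (density P R)"
    and R [measurable]: "R \<in> borel_measurable P" and nn: "\<And>x. 0 \<le> R x" and I: "finite I"
  shows "PiM I (\<lambda>_. density P R) = density (PiM I (\<lambda>_. P)) (\<lambda>\<omega>. \<Prod>i\<in>I. R (\<omega> i))"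
proof -
  interpret P: prob_space P by fact
  interpret Q: prob_space "density P R" by fact
  interpret PP: product_sigma_finite "\<lambda>_. P" ..
  interpret QQ: product_sigma_finite "\<lambda>_. density P R" ..
  have "density (PiM I (\<lambda>_. P)) (\<lambda>\<omega>. \<Prod>i\<in>I. R (\<omega> i)) = PiM I (\<lambda>_. density P R)"
  proof (rule QQ.PiM_eqI[OF I])
    show "sets (density (PiM I (\<lambda>_. P)) (\<lambda>\<omega>. \<Prod>i\<in>I. R (\<omega> i))) = sets (PiM I (\<lambda>_. density P R))"
      by (simp cong: sets_PiM_cong)
    fix A assume A: "\<And>i. i \<in> I \<Longrightarrow> A i \<in> sets (density P R)"
    then have A' [measurable]: "\<And>i. i \<in> I \<Longrightarrow> A i \<in> sets P" by simp
    have [measurable]: "Pi\<^sub>E I A \<in> sets (PiM I (\<lambda>_. P))"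
      by (rule sets_PiM_I_finite[OF I A'])
    have "emeasure (density (PiM I (\<lambda>_. P)) (\<lambda>\<omega>. \<Prod>i\<in>I. R (\<omega> i))) (Pi\<^sub>E I A) =
      (\<integral>\<^sup>+\<omega>. ennreal (\<Prod>i\<in>I. R (\<omega> i)) * indicator (Pi\<^sub>E I A) \<omega> \<partial>PiM I (\<lambda>_. P))"
      by (subst emeasure_density) auto
    also have "\<dots> = (\<integral>\<^sup>+\<omega>. (\<Prod>i\<in>I. ennreal (R (\<omega> i)) * indicator (A i) (\<omega> i)) \<partial>PiM I (\<lambda>_. P))"
    proof (rule nn_integral_cong)
      fix \<omega> assume "\<omega> \<in> space (PiM I (\<lambda>_. P))"
      then have "indicator (Pi\<^sub>E I A) \<omega> = (\<Prod>i\<in>I. indicator (A i) (\<omega> i) :: ennreal)"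
        using I by (auto simp: indicator_def space_PiM PiE_iff prod_zero_iff)
      then show "ennreal (\<Prod>i\<in>I. R (\<omega> i)) * indicator (Pi\<^sub>E I A) \<omega> =
          (\<Prod>i\<in>I. ennreal (R (\<omega> i)) * indicator (A i) (\<omega> i))"
        by (simp add: prod.distrib prod_ennreal nn)
    qed
    also have "\<dots> = (\<Prod>i\<in>I. \<integral>\<^sup>+x. ennreal (R x) * indicator (A i) x \<partial>P)"
      by (rule PP.product_nn_integral_prod[OF I]) auto
    also have "\<dots> = (\<Prod>i\<in>I. emeasure (density P R) (A i))"
      by (intro prod.cong refl, subst emeasure_density) auto
    finally show "emeasure (density (PiM I (\<lambda>_. P)) (\<lambda>\<omega>. \<Prod>i\<in>I. R (\<omega> i))) (Pi\<^sub>E I A) =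
      (\<Prod>i\<in>I. emeasure (density P R) (A i))" .
  qed
  then show ?thesis by simp
qed

text \<open>Cauchy-Schwarz for the likelihood ratio \<open>\<Lambda>\<close> of the products: the
  difference is the integral of \<open>\<Lambda> - 1\<close> over \<open>A\<close>, so its square is
  at most the second moment of \<open>\<Lambda>\<close> minus 1, and that moment is the
  \<open>card I\<close>-th power of a one-dimensional one. \<open>\<kappa>\<close> bounds the
  chi-square divergence of \<open>density P R\<close> from \<open>P\<close>.\<close>

lemma PiM_density_diff_le:
  fixes R :: "'a \<Rightarrow> real"
  assumes P: "prob_space P" and Q: "prob_space (density P R)"
    and R [measurable]: "R \<in> borel_measurable P" and nn: "\<And>x. 0 \<le> R x" and I: "finite I"
    and chi: "(\<integral>\<^sup>+x. ennreal ((R x - 1)\<^sup>2) \<partial>P) \<le> ennreal \<kappa>" and chi0: "0 \<le> \<kappa>"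
    and A [measurable]: "A \<in> sets (PiM I (\<lambda>_. P))"
  shows "\<bar>measure (PiM I (\<lambda>_. density P R)) A - measure (PiM I (\<lambda>_. P)) A\<bar> \<le> sqrt ((1 + \<kappa>) ^ card I - 1)"
proof -
  interpret P: prob_space P by fact
  interpret Q: prob_space "density P R" by fact
  interpret PP: product_sigma_finite "\<lambda>_. P" ..
  interpret PI: prob_space "PiM I (\<lambda>_. P)" by (intro prob_space_PiM P)
  interpret QI: prob_space "PiM I (\<lambda>_. density P R)" by (intro prob_space_PiM Q)
  define \<Lambda> where "\<Lambda> \<omega> = (\<Prod>i\<in>I. R (\<omega> i))" for \<omega> :: "'b \<Rightarrow> 'a"
  have [measurable]: "\<Lambda> \<in> borel_measurable (PiM I (\<lambda>_. P))"
    unfolding \<Lambda>_def by measurable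
  have \<Lambda>0: "0 \<le> \<Lambda> \<omega>" for \<omega>
    unfolding \<Lambda>_def by (intro prod_nonneg nn)
  have dens: "PiM I (\<lambda>_. density P R) = density (PiM I (\<lambda>_. P)) \<Lambda>"
    unfolding \<Lambda>_def by (rule PiM_density[OF P Q R nn I])
  have "emeasure (density P R) (space P) = 1"
    using Q.emeasure_space_1 by simp
  then have R1: "(\<integral>\<^sup>+x. ennreal (R x) \<partial>P) = 1"
    by (simp add: emeasure_density cong: nn_integral_cong)
  have iR: "integrable P R"
    using R1 nn by (intro integrableI_nonneg) auto
  have ER: "(\<integral>x. R x \<partial>P) = 1"
    using R1 nn by (simp add: integral_eq_nn_integral)
  have id2: "integrable P (\<lambda>x. (R x - 1)\<^sup>2)"
    using le_less_trans[OF chi ennreal_less_top] by (intro integrableI_nonneg) auto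
  have Ed2: "(\<integral>x. (R x - 1)\<^sup>2 \<partial>P) \<le> \<kappa>"
    using enn2real_mono[OF chi] chi0 by (simp add: integral_eq_nn_integral)
  \<comment> \<open>The hypothesis controls \<open>(R - 1)^2\<close>; with the mean 1 of
    \<open>R\<close>, this expansion turns it into the bound \<open>1 + \<kappa>\<close> on the
    second moment.\<close>
  have sq: "(R x)\<^sup>2 = (R x - 1)\<^sup>2 + 2 * R x - 1" for x
    by (simp add: power2_eq_square algebra_simps)
  have iR2: "integrable P (\<lambda>x. (R x)\<^sup>2)"
    unfolding sq using iR id2 by auto
  have ER2: "(\<integral>x. (R x)\<^sup>2 \<partial>P) \<le> 1 + \<kappa>"
    unfolding sq using iR id2 Ed2 ER by (simp add: P.prob_space)
  have i1: "integrable (PiM I (\<lambda>_. P)) \<Lambda>"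
    unfolding \<Lambda>_def by (rule PP.product_integrable_prod[OF I iR])
  have e1: "(\<integral>\<omega>. \<Lambda> \<omega> \<partial>PiM I (\<lambda>_. P)) = 1"
    unfolding \<Lambda>_def using PP.product_integral_prod[OF I iR] ER by simp
  have i2: "integrable (PiM I (\<lambda>_. P)) (\<lambda>\<omega>. (\<Lambda> \<omega>)\<^sup>2)"
    unfolding \<Lambda>_def prod_power_distrib by (rule PP.product_integrable_prod[OF I iR2])
  have e2: "(\<integral>\<omega>. (\<Lambda> \<omega>)\<^sup>2 \<partial>PiM I (\<lambda>_. P)) \<le> (1 + \<kappa>) ^ card I"
  proof -
    have "(\<integral>\<omega>. (\<Lambda> \<omega>)\<^sup>2 \<partial>PiM I (\<lambda>_. P)) = (\<integral>x. (R x)\<^sup>2 \<partial>P) ^ card I"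
      unfolding \<Lambda>_def prod_power_distrib using PP.product_integral_prod[OF I iR2] by simp
    also have "\<dots> \<le> (1 + \<kappa>) ^ card I"
      by (intro power_mono ER2) auto
    finally show ?thesis .
  qed
  define X where "X \<omega> = indicator A \<omega> * (\<Lambda> \<omega> - 1)" for \<omega>
  have iX: "integrable (PiM I (\<lambda>_. P)) X"
    unfolding X_def using integrable_real_mult_indicator[OF A, of "\<lambda>\<omega>. \<Lambda> \<omega> - 1"] i1
    by (simp add: mult.commute)
  have iY: "integrable (PiM I (\<lambda>_. P)) (\<lambda>\<omega>. (\<Lambda> \<omega> - 1)\<^sup>2)"
    using i1 i2 by (simp add: power2_diff)
  have XY: "(X \<omega>)\<^sup>2 \<le> (\<Lambda> \<omega> - 1)\<^sup>2" for \<omega>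
    by (simp add: X_def indicator_def)
  have iX2: "integrable (PiM I (\<lambda>_. P)) (\<lambda>\<omega>. (X \<omega>)\<^sup>2)"
    by (rule Bochner_Integration.integrable_bound[OF iY]) (use XY in \<open>auto simp: X_def\<close>)
  have m1: "measure (PiM I (\<lambda>_. density P R)) A = (\<integral>\<omega>. indicator A \<omega> * \<Lambda> \<omega> \<partial>PiM I (\<lambda>_. P))"
  proof -
    have "measure (PiM I (\<lambda>_. density P R)) A = (\<integral>\<omega>. indicator A \<omega> \<partial>density (PiM I (\<lambda>_. P)) \<Lambda>)"
      unfolding dens using sets.sets_into_space[OF A] by (simp add: Int_absorb1)
    also have "\<dots> = (\<integral>\<omega>. \<Lambda> \<omega> *\<^sub>R indicator A \<omega> \<partial>PiM I (\<lambda>_. P))"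
      by (rule integral_density) (auto simp: \<Lambda>0)
    finally show ?thesis by (simp add: mult.commute)
  qed
  have iA: "integrable (PiM I (\<lambda>_. P)) (\<lambda>\<omega>. indicator A \<omega> * \<Lambda> \<omega>)"
    using integrable_real_mult_indicator[OF A i1] by (simp add: mult.commute)
  have diff: "measure (PiM I (\<lambda>_. density P R)) A - measure (PiM I (\<lambda>_. P)) A = PI.expectation X"
  proof -
    have "integrable (PiM I (\<lambda>_. P)) (indicator A :: _ \<Rightarrow> real)"
      using PI.emeasure_finite[of A] by (simp add: less_top[symmetric])
    from Bochner_Integration.integral_diff[OF iA this] show ?thesis
      unfolding m1 X_def right_diff_distrib
      using sets.sets_into_space[OF A] by (simp add: Int_absorb1)
  qed
  \<comment> \<open>Cauchy-Schwarz against the constant 1, in the form of a nonnegative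
    variance.\<close>
  have "(PI.expectation X)\<^sup>2 \<le> PI.expectation (\<lambda>\<omega>. (X \<omega>)\<^sup>2)"
    using PI.variance_eq[OF iX iX2] PI.variance_positive[of X] by linarith
  also have "\<dots> \<le> PI.expectation (\<lambda>\<omega>. (\<Lambda> \<omega> - 1)\<^sup>2)"
    by (intro integral_mono iX2 iY XY)
  also have "\<dots> = PI.expectation (\<lambda>\<omega>. (\<Lambda> \<omega>)\<^sup>2) - 1"
    using i1 i2 e1 by (simp add: power2_diff PI.prob_space)
  also have "\<dots> \<le> (1 + \<kappa>) ^ card I - 1"
    using e2 by simp
  finally show ?thesis
    unfolding diff by (simp add: real_le_rsqrt)
qed

section \<open>Baire category in a closed subset of a complete space\<close>

text \<open>By hypothesis the relative interior of the set where \<open>A N\<close> holds is dense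
  for each \<open>N\<close>. A closed subset of a complete space is complete, so Baire's theorem
  makes the intersection of these interiors dense, and nonempty because \<open>X\<close> is.\<close>

lemma Baire_closed:
  fixes X :: "'a::complete_space set"
  assumes X: "closed X" "X \<noteq> {}"
    and dense: "\<And>N v \<delta>. v \<in> X \<Longrightarrow> \<delta> > 0 \<Longrightarrow>
      \<exists>v'\<in>X. dist v v' < \<delta> \<and> (\<exists>r>0. \<forall>w\<in>X. dist v' w < r \<longrightarrow> A N w)"
  shows "\<exists>v\<in>X. \<forall>N::nat. A N v"
proof -
  interpret S: Submetric UNIV "dist :: 'a \<Rightarrow> 'a \<Rightarrow> real" X
    by unfold_locales auto
  have "S.sub.mcomplete"
    by (rule S.closedin_mcomplete_imp_mcomplete) (use X complete_UNIV in auto)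
  define D where "D N = {v\<in>X. \<exists>r>0. \<forall>w\<in>X. dist v w < r \<longrightarrow> A N w}" for N
  have "S.sub.mtopology closure_of \<Inter>(range D) = X"
  proof (rule S.sub.metric_Baire_category)
    fix T assume "T \<in> range D"
    then obtain N where T: "T = D N" by auto
    have "openin S.sub.mtopology (D N)"
      unfolding S.sub.openin_mtopology
    proof (intro conjI allI impI)
      show "D N \<subseteq> X" by (auto simp: D_def)
      fix v assume "v \<in> D N"
      then obtain r where r: "r > 0" "\<And>w. w \<in> X \<Longrightarrow> dist v w < r \<Longrightarrow> A N w" "v \<in> X"
        by (auto simp: D_def)
      have "S.sub.mball v (r/2) \<subseteq> D N"
      proof
        fix w assume "w \<in> S.sub.mball v (r/2)"
        then have w: "w \<in> X" "dist v w < r/2" by auto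
        have "\<forall>w'\<in>X. dist w w' < r/2 \<longrightarrow> A N w'"
        proof (intro ballI impI)
          fix w' assume w': "w' \<in> X" "dist w w' < r/2"
          have "dist v w' < r"
            using dist_triangle[of v w' w] w w' by linarith
          then show "A N w'" using r w' by blast
        qed
        with w r show "w \<in> D N"
          unfolding D_def by (auto intro!: exI[of _ "r/2"])
      qed
      then show "\<exists>r>0. S.sub.mball v r \<subseteq> D N"
        using r by (intro exI[of _ "r/2"]) auto
    qed
    moreover have "S.sub.mtopology closure_of (D N) = X"
    proof -
      have "v \<in> S.sub.mtopology closure_of (D N)" if v: "v \<in> X" for v
        unfolding S.sub.metric_closure_of
      proof (clarsimp simp: v)
        fix \<delta> :: real assume "\<delta> > 0"
        from dense[OF v this, of N] obtain v' where "v' \<in> X" "dist v v' < \<delta>"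
          "\<exists>r>0. \<forall>w\<in>X. dist v' w < r \<longrightarrow> A N w" by auto
        then show "\<exists>y\<in>D N. y \<in> X \<and> dist v y < \<delta>"
          by (auto simp: D_def)
      qed
      then show ?thesis
        using closure_of_subset_topspace[of S.sub.mtopology "D N"] by auto
    qed
    ultimately show "openin S.sub.mtopology T \<and> S.sub.mtopology closure_of T = X"
      by (simp add: T)
  qed (use \<open>S.sub.mcomplete\<close> in auto)
  with X have "\<Inter>(range D) \<noteq> {}"
    by (metis closure_of_empty)
  then obtain v where v: "\<And>N. v \<in> D N" by auto
  have "A N v" for N
    using v[of N] by (auto simp: D_def)
  moreover have "v \<in> X"
    using v by (auto simp: D_def)
  ultimately show ?thesis
    by blast
qed

subsection \<open>Densities on \<open>Omega\<close>\<close>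

lemma borel_measurable_base_measure:
  fixes F :: "real \<times> int \<Rightarrow> 'a::topological_space"
  assumes "\<And>y. y \<in> {-1, 1} \<Longrightarrow> (\<lambda>x. F (x, y)) \<in> borel_measurable (restrict_space lborel {0..1})"
  shows "F \<in> borel_measurable base_measure"
  unfolding base_measure_def
  by (subst measurable_pair_swap_iff) (rule measurable_pair_measure_countable1, use assms in auto)

lemma nn_integral_base_measure:
  assumes "F \<in> borel_measurable base_measure"
  shows "(\<integral>\<^sup>+\<omega>. F \<omega> \<partial>base_measure) = (\<integral>\<^sup>+x\<in>{0..1}. (F (x, 1) + F (x, -1)) \<partial>lborel)"
proof -
  interpret C: sigma_finite_measure "count_space {-1, 1::int}"
    by (intro sigma_finite_measure_count_space_finite) auto
  have "(\<integral>\<^sup>+\<omega>. F \<omega> \<partial>base_measure) =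
      (\<integral>\<^sup>+x. \<integral>\<^sup>+y. F (x, y) \<partial>count_space {-1, 1} \<partial>restrict_space lborel {0..1})"
    using C.nn_integral_fst[OF assms[unfolded base_measure_def]] by (simp add: base_measure_def)
  then show ?thesis
    by (simp add: nn_integral_count_space_finite nn_integral_restrict_space add.commute)
qed

text \<open>The classifier errs on label 1 to the left of \<open>\<alpha>\<close> and on label -1
  from \<open>\<alpha>\<close> on. Writing the right part as the full integral minus its left part
  leaves an antiderivative of the difference of the branches. Clamping \<open>\<alpha>\<close> to
  the unit interval changes the classifier at most on a null set.\<close>

lemma prediction_error_density:
  assumes P: "is_C1_density P f"
  shows "prediction_error P \<alpha> = integral {0..1} (\<lambda>x. f (x, -1)) +
    integral {0..max 0 (min 1 \<alpha>)} (\<lambda>x. f (x, 1) - f (x, -1))"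
proof -
  have C: "C1_Omega f" and nn: "\<And>\<omega>. \<omega> \<in> Omega \<Longrightarrow> 0 \<le> f \<omega>"
    and P_eq: "P = density base_measure (\<lambda>\<omega>. ennreal (f \<omega>))"
    using P by (auto simp: is_C1_density_def)
  note [measurable] = borel_measurable_C1_Omega[OF C]
  define c where "c = max 0 (min 1 \<alpha>)"
  have c: "0 \<le> c" "c \<le> 1" by (auto simp: c_def)
  have int: "(\<lambda>x. f (x, y)) integrable_on {a..b}" if "y \<in> {-1, 1}" "0 \<le> a" "b \<le> 1" for y a b
    by (intro integrable_continuous_interval continuous_on_subset[OF C1_Omega_cont[OF C that(1)]])
      (use that in auto)
  define I where "I = integral {0..c} (\<lambda>x. f (x, 1)) + integral {c..1} (\<lambda>x. f (x, -1))"
  define h where "h x = (if x \<ge> \<alpha> then f (x, -1) else f (x, 1))" for x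
  have "(h has_integral I) {0..1}"
    unfolding I_def
  proof (rule has_integral_combine[OF c])
    \<comment> \<open>\<open>h\<close> can disagree with the chosen branch only at the endpoint
      \<open>c\<close>; if \<open>\<alpha>\<close> lies outside the unit interval, one of the two
      intervals is that single point.\<close>
    show "(h has_integral integral {0..c} (\<lambda>x. f (x, 1))) {0..c}"
      by (rule has_integral_spike_finite[OF _ _ integrable_integral[OF int], of "{c}"])
        (use c in \<open>auto simp: h_def c_def max_def min_def split: if_splits\<close>)
    show "(h has_integral integral {c..1} (\<lambda>x. f (x, -1))) {c..1}"
      by (rule has_integral_spike_finite[OF _ _ integrable_integral[OF int], of "{c}"])
        (use c in \<open>auto simp: h_def c_def max_def min_def split: if_splits\<close>)
  qed
  moreover have hn: "0 \<le> h x" if "x \<in> {0..1}" for x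
    using that nn by (auto simp: h_def Omega_def)
  ultimately have h_int: "(\<integral>\<^sup>+x. ennreal (indicator {0..1} x * h x) \<partial>lborel) = ennreal I"
    using nn_integral_has_integral_lebesgue by blast
  have I0: "0 \<le> I"
    using \<open>(h has_integral I) {0..1}\<close> hn by (rule has_integral_nonneg)
  define E where "E = {\<omega> \<in> space P. threshold_classifier \<alpha> (fst \<omega>) \<noteq> snd \<omega>}"
  have E_eq: "E = {\<omega> \<in> space base_measure. (if fst \<omega> \<ge> \<alpha> then 1 else -1) \<noteq> snd \<omega>}"
    by (simp add: E_def P_eq threshold_classifier_def)
  have fst_m [measurable]: "fst \<in> borel_measurable base_measure"
    unfolding base_measure_def by (rule measurable_fst'') (simp_all add: measurable_restrict_space1)
  have snd_m [measurable]: "snd \<in> measurable base_measure (count_space UNIV)"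
    unfolding base_measure_def by (rule measurable_compose[OF measurable_snd]) simp
  have [measurable]: "E \<in> sets base_measure"
    unfolding E_eq by measurable
  have "emeasure P E = (\<integral>\<^sup>+\<omega>. ennreal (f \<omega>) * indicator E \<omega> \<partial>base_measure)"
    unfolding P_eq by (rule emeasure_density) auto
  also have "\<dots> = (\<integral>\<^sup>+x\<in>{0..1}. (ennreal (f (x, 1)) * indicator E (x, 1) +
      ennreal (f (x, -1)) * indicator E (x, -1)) \<partial>lborel)"
    by (rule nn_integral_base_measure) measurable
  also have "\<dots> = (\<integral>\<^sup>+x. ennreal (indicator {0..1} x * h x) \<partial>lborel)"
    by (rule nn_integral_cong)
      (auto simp: indicator_def E_eq h_def space_base_measure Omega_def)
  also note h_int
  finally have "prediction_error P \<alpha> = I"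
    using I0 by (simp add: prediction_error_def E_def[symmetric] measure_def)
  moreover have "integral {0..c} (\<lambda>x. f (x, 1) - f (x, -1)) =
      integral {0..c} (\<lambda>x. f (x, 1)) - integral {0..c} (\<lambda>x. f (x, -1))"
    by (rule integral_diff) (use int c in auto)
  moreover have "integral {0..1} (\<lambda>x. f (x, -1)) =
      integral {0..c} (\<lambda>x. f (x, -1)) + integral {c..1} (\<lambda>x. f (x, -1))"
    by (rule Henstock_Kurzweil_Integration.integral_combine[symmetric]) (use int c in auto)
  ultimately show ?thesis
    unfolding I_def c_def by simp
qed

lemma partial1_eqI:
  assumes "((\<lambda>t. F (t, y)) has_vector_derivative D) (at x within {0..1})" "x \<in> {0..1}"
  shows "partial1 F (x, y) = D"
  using vector_derivative_within_closed_interval[OF _ assms(2,1)] by (simp add: partial1_def)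

lemma C1_OmegaI:
  assumes "\<And>x y. x \<in> {0..1} \<Longrightarrow> y \<in> {-1, 1} \<Longrightarrow>
      ((\<lambda>t. F (t, y)) has_vector_derivative F' (x, y)) (at x within {0..1})"
    and "\<And>y. y \<in> {-1, 1} \<Longrightarrow> continuous_on {0..1} (\<lambda>x. F' (x, y))"
  shows "C1_Omega F"
  unfolding C1_Omega_def
proof (intro ballI conjI)
  fix y :: int assume y: "y \<in> {-1, 1}"
  show "(\<lambda>t. F (t, y)) differentiable (at x within {0..1})" if "x \<in> {0..1}" for x
    using assms(1)[OF that y] by (auto simp: differentiable_def has_vector_derivative_def)
  show "continuous_on {0..1} (\<lambda>x. partial1 F (x, y))"
    using assms(2)[OF y] by (rule continuous_on_eq) (use y in \<open>auto intro!: partial1_eqI[symmetric] assms(1)\<close>)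
qed

text \<open>\<open>dens\<close> is a choice whose values off \<open>Omega\<close> are arbitrary.
  Since \<open>partial1\<close> differentiates within the unit interval, agreement on
  \<open>Omega\<close> suffices to carry derivatives over to an explicit density.\<close>

lemma partial1_cong_Omega:
  assumes "C1_Omega F" "\<And>\<omega>. \<omega> \<in> Omega \<Longrightarrow> F \<omega> = H \<omega>" "\<omega> \<in> Omega"
  shows "partial1 F \<omega> = partial1 H \<omega>"
proof -
  obtain x y where w: "\<omega> = (x, y)" "x \<in> {0..1}" "y \<in> {-1, 1}"
    using assms(3) by (auto simp: Omega_def)
  have "((\<lambda>t. H (t, y)) has_vector_derivative partial1 F (x, y)) (at x within {0..1})"
    by (rule has_vector_derivative_transform[OF w(2) _ C1_Omega_deriv[OF assms(1) w(2,3)]])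
      (use assms(2) w in \<open>auto simp: Omega_def\<close>)
  from partial1_eqI[OF this w(2)] show ?thesis
    by (simp add: w)
qed

subsection \<open>Perturbations of a density near its crossing\<close>

text \<open>The window \<open>{l..u}\<close> surrounds the crossing. A perturbation bounded by
  \<open>\<epsilon>\<close> together with its derivative lowers a branch by at most
  \<open>\<epsilon>\<close> and alters the slope of the difference by at most
  \<open>2 * \<epsilon>\<close>. The margins absorb this: branches stay above
  \<open>\<epsilon>\<close> and the slope stays between \<open>s\<close> and \<open>S\<close>.
  \<open>left\<close> and \<open>right\<close> exclude crossings outside the window.\<close>

locale crossing_window =
  fixes f :: "real \<times> int \<Rightarrow> real" and l u s S \<epsilon> :: real
  assumes C1: "C1_Omega f"
    and nonneg: "\<omega> \<in> Omega \<Longrightarrow> 0 \<le> f \<omega>"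
    and prob: "prob_space (density base_measure f)"
    and window: "0 < l" "l < u" "u < 1"
    and s_pos: "0 < s" and eps_pos: "0 < \<epsilon>"
    and lower: "x \<in> {l..u} \<Longrightarrow> y \<in> {-1, 1} \<Longrightarrow> 2 * \<epsilon> \<le> f (x, y)"
    and slope_ge: "x \<in> {l..u} \<Longrightarrow> s + 2 * \<epsilon> \<le> partial1 f (x, 1) - partial1 f (x, -1)"
    and slope_le: "x \<in> {l..u} \<Longrightarrow> partial1 f (x, 1) - partial1 f (x, -1) \<le> S - 2 * \<epsilon>"
    and left: "x \<in> {0..l} \<Longrightarrow> f (x, 1) < f (x, -1)"
    and right: "x \<in> {u..1} \<Longrightarrow> f (x, -1) < f (x, 1)"
begin

text \<open>The slopes \<open>\<psi>'\<close> of the admissible perturbations \<open>\<psi>\<close>; the vanishing integral makes \<open>\<psi>\<close> vanish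
  to the right of the window.\<close>

definition directions :: "(real \<Rightarrow>\<^sub>C real) set" where
  "directions = {v :: real \<Rightarrow>\<^sub>C real. (\<forall>x. x \<notin> {l..u} \<longrightarrow> apply_bcontfun v x = 0) \<and>
    integral {0..1} (apply_bcontfun v) = 0 \<and> norm v \<le> \<epsilon>}"

definition psi :: "(real \<Rightarrow>\<^sub>C real) \<Rightarrow> real \<Rightarrow> real" where
  "psi v x = integral {0..x} (apply_bcontfun v)"

definition pdens :: "(real \<Rightarrow>\<^sub>C real) \<Rightarrow> real \<times> int \<Rightarrow> real" where
  "pdens v \<omega> = f \<omega> + of_int (snd \<omega>) * psi v (fst \<omega>)"

definition pmeas :: "(real \<Rightarrow>\<^sub>C real) \<Rightarrow> (real \<times> int) measure" where
  "pmeas v = density base_measure (\<lambda>\<omega>. ennreal (pdens v \<omega>))"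

definition gap :: "(real \<Rightarrow>\<^sub>C real) \<Rightarrow> real \<Rightarrow> real" where
  "gap v x = pdens v (x, 1) - pdens v (x, -1)"

lemma integrable_direction: "apply_bcontfun v integrable_on {a..b :: real}" for v :: "real \<Rightarrow>\<^sub>C real"
  by (intro integrable_continuous_interval) auto

lemma integral_dist_le:
  fixes v w :: "real \<Rightarrow>\<^sub>C real"
  assumes "0 \<le> x" "x \<le> 1"
  shows "\<bar>integral {0..x} (apply_bcontfun v) - integral {0..x} (apply_bcontfun w)\<bar> \<le> dist v w"
proof -
  have "integral {0..x} (apply_bcontfun v) - integral {0..x} (apply_bcontfun w) =
      integral {0..x} (\<lambda>t. apply_bcontfun v t - apply_bcontfun w t)"
    by (rule Henstock_Kurzweil_Integration.integral_diff[symmetric]) (rule integrable_direction)+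
  moreover have "norm (integral {0..x} (\<lambda>t. apply_bcontfun v t - apply_bcontfun w t)) \<le> dist v w * (x - 0)"
    by (rule integral_bound) (use assms dist_bounded[of v _ w] in
        \<open>auto simp: dist_real_def intro!: continuous_intros\<close>)
  moreover have "dist v w * x \<le> dist v w"
    using assms by (simp add: mult_left_le)
  ultimately show ?thesis by simp
qed

lemma psi_dist_le: "x \<in> {0..1} \<Longrightarrow> \<bar>psi v x - psi w x\<bar> \<le> dist v w"
  unfolding psi_def by (rule integral_dist_le) auto

lemma psi_zero [simp]: "psi 0 x = 0"
  by (simp add: psi_def)

lemma psi_bound: "v \<in> directions \<Longrightarrow> x \<in> {0..1} \<Longrightarrow> \<bar>psi v x\<bar> \<le> \<epsilon>"
  using psi_dist_le[of x v 0] by (simp add: directions_def)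

lemma direction_bound: "v \<in> directions \<Longrightarrow> \<bar>apply_bcontfun v x\<bar> \<le> \<epsilon>"
  using norm_bounded[of v x] by (simp add: directions_def)

lemma psi_outside:
  assumes "v \<in> directions" "x \<in> {0..1}" "x \<le> l \<or> u \<le> x"
  shows "psi v x = 0"
proof -
  \<comment> \<open>Strict inequalities, since \<open>directions\<close> forces zeros only off the
    closed window; the integrals below therefore except the endpoint \<open>x\<close>.\<close>
  have z: "apply_bcontfun v x = 0" if "x < l \<or> u < x" for x
    using assms that by (auto simp: directions_def)
  show ?thesis
    using assms(3)
  proof
    assume "x \<le> l"
    have "(apply_bcontfun v has_integral 0) {0..x}"
      by (rule has_integral_spike_finite[OF _ _ has_integral_0, of "{x}"]) (use \<open>x \<le> l\<close> z in auto)
    then show ?thesis by (simp add: psi_def integral_unique)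
  next
    assume "u \<le> x"
    have "(apply_bcontfun v has_integral 0) {x..1}"
      by (rule has_integral_spike_finite[OF _ _ has_integral_0, of "{x}"]) (use \<open>u \<le> x\<close> z in auto)
    moreover have "integral {0..1} (apply_bcontfun v) =
        integral {0..x} (apply_bcontfun v) + integral {x..1} (apply_bcontfun v)"
      by (rule Henstock_Kurzweil_Integration.integral_combine[symmetric])
        (use assms in \<open>auto intro: integrable_direction\<close>)
    moreover have "integral {0..1} (apply_bcontfun v) = 0"
      using assms by (simp add: directions_def)
    ultimately show ?thesis by (simp add: psi_def integral_unique)
  qed
qed

lemma psi_deriv:
  assumes "x \<in> {0..1}"
  shows "(psi v has_vector_derivative apply_bcontfun v x) (at x within {0..1})"
  unfolding psi_def[abs_def] by (rule integral_has_vector_derivative) (use assms in auto)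

lemma psi_cont: "continuous_on {0..1} (psi v)"
  unfolding continuous_on_eq_continuous_within
  by (blast intro: has_vector_derivative_continuous psi_deriv)

lemma pdens_deriv:
  assumes "x \<in> {0..1}" "y \<in> {-1, 1}"
  shows "((\<lambda>t. pdens v (t, y)) has_vector_derivative partial1 f (x, y) + of_int y * apply_bcontfun v x)
    (at x within {0..1})"
  unfolding pdens_def fst_conv snd_conv
  by (intro has_vector_derivative_add C1_Omega_deriv[OF C1] has_vector_derivative_mult_right
      psi_deriv assms)

lemma partial1_pdens:
  assumes "\<omega> \<in> Omega"
  shows "partial1 (pdens v) \<omega> = partial1 f \<omega> + of_int (snd \<omega>) * apply_bcontfun v (fst \<omega>)"
proof -
  obtain x y where "\<omega> = (x, y)" "x \<in> {0..1}" "y \<in> {-1, 1}"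
    using assms by (auto simp: Omega_def)
  then show ?thesis
    using partial1_eqI[OF pdens_deriv] by simp
qed

lemma C1_pdens: "C1_Omega (pdens v)"
proof (rule C1_OmegaI)
  fix x :: real and y :: int assume "x \<in> {0..1}" "y \<in> {-1, 1}"
  then show "((\<lambda>t. pdens v (t, y)) has_vector_derivative
      (\<lambda>(x, y). partial1 f (x, y) + of_int y * apply_bcontfun v x) (x, y)) (at x within {0..1})"
    using pdens_deriv by simp
next
  fix y :: int assume "y \<in> {-1, 1}"
  then show "continuous_on {0..1} (\<lambda>x. (\<lambda>(x, y). partial1 f (x, y) + of_int y * apply_bcontfun v x) (x, y))"
    using C1 by (auto simp: C1_Omega_def intro!: continuous_intros)
qed

lemma pdens_ge:
  assumes "v \<in> directions" "x \<in> {l..u}" "y \<in> {-1, 1}"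
  shows "\<epsilon> \<le> pdens v (x, y)"
proof -
  have "\<bar>of_int y * psi v x\<bar> \<le> \<epsilon>"
    using psi_bound[OF assms(1), of x] assms window by (auto simp: abs_mult)
  then show ?thesis
    using lower[OF assms(2,3)] by (simp add: pdens_def abs_le_iff)
qed

lemma pdens_outside:
  "v \<in> directions \<Longrightarrow> x \<in> {0..1} \<Longrightarrow> x \<le> l \<or> u \<le> x \<Longrightarrow> pdens v (x, y) = f (x, y)"
  by (simp add: pdens_def psi_outside)

lemma pdens_nonneg:
  assumes "v \<in> directions" "\<omega> \<in> Omega"
  shows "0 \<le> pdens v \<omega>"
proof -
  obtain x y where w: "\<omega> = (x, y)" "x \<in> {0..1}" "y \<in> {-1, 1}"
    using assms(2) by (auto simp: Omega_def)
  show ?thesis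
  proof (cases "x \<in> {l..u}")
    case True
    then show ?thesis using pdens_ge[OF assms(1) True w(3)] eps_pos w by simp
  next
    case False
    then show ?thesis
      using pdens_outside[OF assms(1) w(2)] nonneg[OF assms(2)] w by auto
  qed
qed

lemma pdens_measurable [measurable]: "pdens v \<in> borel_measurable base_measure"
  by (rule borel_measurable_C1_Omega[OF C1_pdens])

lemma C1_density_pmeas: "v \<in> directions \<Longrightarrow> is_C1_density (pmeas v) (pdens v)"
  by (simp add: is_C1_density_def C1_pdens pdens_nonneg pmeas_def)

text \<open>The branches change by \<open>psi v\<close> and \<open>- psi v\<close>, so their sum,
  the density of the first coordinate, and with it the total mass stay the same.\<close>

lemma prob_pmeas:
  assumes v: "v \<in> directions"
  shows "prob_space (pmeas v)"
proof
  have fm: "f \<in> borel_measurable base_measure"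
    by (rule borel_measurable_C1_Omega[OF C1])
  have "emeasure (pmeas v) (space (pmeas v)) = (\<integral>\<^sup>+\<omega>. ennreal (pdens v \<omega>) \<partial>base_measure)"
    by (simp add: pmeas_def emeasure_density cong: nn_integral_cong)
  also have "\<dots> = (\<integral>\<^sup>+x\<in>{0..1}. (ennreal (pdens v (x, 1)) + ennreal (pdens v (x, -1))) \<partial>lborel)"
    by (rule nn_integral_base_measure) measurable
  also have "\<dots> = (\<integral>\<^sup>+x\<in>{0..1}. (ennreal (f (x, 1)) + ennreal (f (x, -1))) \<partial>lborel)"
  proof (rule nn_integral_cong)
    fix x :: real
    show "(ennreal (pdens v (x, 1)) + ennreal (pdens v (x, -1))) * indicator {0..1} x =
        (ennreal (f (x, 1)) + ennreal (f (x, -1))) * indicator {0..1} x"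
    proof (cases "x \<in> {0..1}")
      case True
      then have "(x, 1) \<in> Omega" "(x, -1) \<in> Omega" by (auto simp: Omega_def)
      then have "0 \<le> pdens v (x, 1)" "0 \<le> pdens v (x, -1)" "0 \<le> f (x, 1)" "0 \<le> f (x, -1)"
        by (auto intro: pdens_nonneg[OF v] nonneg)
      \<comment> \<open>The four signs permit adding in the reals first, where the two occurrences
        of \<open>psi v\<close> cancel.\<close>
      then show ?thesis
        by (simp add: ennreal_plus[symmetric] del: ennreal_plus) (simp add: pdens_def)
    qed simp
  qed
  also have "\<dots> = (\<integral>\<^sup>+\<omega>. ennreal (f \<omega>) \<partial>base_measure)"
    by (rule nn_integral_base_measure[symmetric]) (use fm in measurable)
  also have "\<dots> = emeasure (density base_measure f) (space (density base_measure f))"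
    using fm by (simp add: emeasure_density cong: nn_integral_cong)
  also have "\<dots> = 1"
    by (rule prob_space.emeasure_space_1[OF prob])
  finally show "emeasure (pmeas v) (space (pmeas v)) = 1" .
qed

lemma pmeas_P_tilde: "v \<in> directions \<Longrightarrow> pmeas v \<in> P_tilde"
  using prob_pmeas C1_density_pmeas by (auto simp: P_tilde_def)

lemma dens_pmeas:
  assumes "v \<in> directions" "\<omega> \<in> Omega"
  shows "dens (pmeas v) \<omega> = pdens v \<omega>"
  by (rule dens_unique[OF is_C1_density_dens[OF pmeas_P_tilde] C1_density_pmeas]) (use assms in auto)

lemma partial1_dens_pmeas:
  assumes "v \<in> directions" "\<omega> \<in> Omega"
  shows "partial1 (dens (pmeas v)) \<omega> = partial1 f \<omega> + of_int (snd \<omega>) * apply_bcontfun v (fst \<omega>)"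
  using partial1_cong_Omega[OF C1_dens dens_pmeas] partial1_pdens assms by simp

lemma gap_eq: "gap v x = f (x, 1) - f (x, -1) + 2 * psi v x"
  by (simp add: gap_def pdens_def)

lemma gap_deriv:
  assumes "x \<in> {0..1}"
  shows "(gap v has_vector_derivative partial1 f (x, 1) - partial1 f (x, -1) + 2 * apply_bcontfun v x)
    (at x within {0..1})"
  unfolding gap_def[abs_def]
  using has_vector_derivative_diff[OF pdens_deriv[OF assms, of 1 v] pdens_deriv[OF assms, of "-1" v]]
  by (simp add: algebra_simps)

lemma gap_cont: "continuous_on {0..1} (gap v)"
  unfolding continuous_on_eq_continuous_within
  by (blast intro: has_vector_derivative_continuous gap_deriv)

text \<open>Mean value theorem: \<open>v\<close> enters the slope of the gap as
  \<open>2 * v\<close>, hence by at most \<open>2 * \<epsilon>\<close>, which is exactly the margin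
  in \<open>slope_ge\<close> and \<open>slope_le\<close>.\<close>

lemma gap_slope:
  assumes v: "v \<in> directions" and x: "l \<le> x" "x \<le> y" "y \<le> u"
  shows "s * (y - x) \<le> gap v y - gap v x" "gap v y - gap v x \<le> S * (y - x)"
proof -
  have "s * (y - x) \<le> gap v y - gap v x \<and> gap v y - gap v x \<le> S * (y - x)"
  proof (cases "x = y")
    case False
    then have "x < y" using x by simp
    have "\<exists>z\<in>{x<..<y}. gap v y - gap v x =
        (\<lambda>h. h * (partial1 f (z, 1) - partial1 f (z, -1) + 2 * apply_bcontfun v z)) (y - x)"
    proof (rule mvt_simple[OF \<open>x < y\<close>])
      fix z assume z: "x \<le> z" "z \<le> y"
      have "(gap v has_vector_derivative partial1 f (z, 1) - partial1 f (z, -1) + 2 * apply_bcontfun v z)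
          (at z within {x..y})"
        by (rule has_vector_derivative_within_subset[OF gap_deriv]) (use x z window in auto)
      then show "(gap v has_derivative (\<lambda>h. h * (partial1 f (z, 1) - partial1 f (z, -1) + 2 * apply_bcontfun v z)))
          (at z within {x..y})"
        by (simp add: has_vector_derivative_def)
    qed
    then obtain z where z: "x < z" "z < y"
      and eq: "gap v y - gap v x = (y - x) * (partial1 f (z, 1) - partial1 f (z, -1) + 2 * apply_bcontfun v z)"
      by auto
    have "z \<in> {l..u}" using x z by auto
    note slope_ge[OF this] slope_le[OF this] direction_bound[OF v, of z]
    then have "s \<le> partial1 f (z, 1) - partial1 f (z, -1) + 2 * apply_bcontfun v z"
      "partial1 f (z, 1) - partial1 f (z, -1) + 2 * apply_bcontfun v z \<le> S"
      by (simp_all add: abs_le_iff)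
    then show ?thesis
      unfolding eq using \<open>x < y\<close> by (simp add: mult.commute mult_right_mono)
  qed simp
  then show "s * (y - x) \<le> gap v y - gap v x" "gap v y - gap v x \<le> S * (y - x)"
    by auto
qed

lemma gap_left: "v \<in> directions \<Longrightarrow> x \<in> {0..l} \<Longrightarrow> gap v x < 0"
  and gap_right: "v \<in> directions \<Longrightarrow> x \<in> {u..1} \<Longrightarrow> 0 < gap v x"
  using left[of x] right[of x] window by (auto simp: gap_eq psi_outside)

lemma gap_zero_ex:
  assumes v: "v \<in> directions"
  obtains a where "l < a" "a < u" "gap v a = 0"
proof -
  have "\<exists>a\<ge>l. a \<le> u \<and> gap v a = 0"
  proof (rule IVT')
    show "continuous_on {l..u} (gap v)"
      by (rule continuous_on_subset[OF gap_cont]) (use window in auto)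
  qed (use gap_left[OF v, of l] gap_right[OF v, of u] window in auto)
  then obtain a where a: "l \<le> a" "a \<le> u" "gap v a = 0" by auto
  then have "a \<noteq> l" "a \<noteq> u"
    using gap_left[OF v, of l] gap_right[OF v, of u] window by auto
  with a that show ?thesis by force
qed

text \<open>The signs outside the window confine zeros to its interior, where the gap grows at rate
  at least \<open>s\<close>.\<close>

lemma gap_zero_unique:
  assumes v: "v \<in> directions" and "a \<in> {0..1}" "gap v a = 0" "b \<in> {0..1}" "gap v b = 0"
  shows "a = b"
proof -
  have *: "l < c \<and> c < u" if "c \<in> {0..1}" "gap v c = 0" for c
    using gap_left[OF v, of c] gap_right[OF v, of c] that by force
  have "c = d" if "c \<in> {0..1}" "gap v c = 0" "d \<in> {0..1}" "gap v d = 0" "c \<le> d" for c d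
  proof -
    have "s * (d - c) \<le> 0"
      using gap_slope(1)[OF v, of c d] *[of c] *[of d] that by simp
    then show ?thesis
      using s_pos that(5) by (simp add: mult_le_0_iff)
  qed
  then show ?thesis
    using assms linear[of a b] by metis
qed

lemma is_crossing_pmeas:
  assumes v: "v \<in> directions"
  shows "is_crossing (pmeas v) a \<longleftrightarrow> a \<in> {0..1} \<and> gap v a = 0"
  using dens_pmeas[OF v] by (auto simp: is_crossing_def gap_def Omega_def)

lemma ex1_crossing:
  assumes v: "v \<in> directions"
  shows "\<exists>!a. is_crossing (pmeas v) a"
proof -
  obtain a where "l < a" "a < u" "gap v a = 0" by (rule gap_zero_ex[OF v])
  then show ?thesis
    using gap_zero_unique[OF v] window
    by (intro ex1I[of _ a]) (auto simp: is_crossing_pmeas[OF v])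
qed

lemma crossing_pmeas:
  assumes v: "v \<in> directions"
  shows "l < crossing (pmeas v)" "crossing (pmeas v) < u" "gap v (crossing (pmeas v)) = 0"
proof -
  have "is_crossing (pmeas v) (crossing (pmeas v))"
    unfolding crossing_def by (rule theI'[OF ex1_crossing[OF v]])
  then have c: "crossing (pmeas v) \<in> {0..1}" "gap v (crossing (pmeas v)) = 0"
    by (auto simp: is_crossing_pmeas[OF v])
  then show "gap v (crossing (pmeas v)) = 0" by simp
  show "l < crossing (pmeas v)" "crossing (pmeas v) < u"
    using gap_left[OF v, of "crossing (pmeas v)"] gap_right[OF v, of "crossing (pmeas v)"] c
    by force+
qed

lemma pmeas_P_class:
  assumes v: "v \<in> directions"
  shows "pmeas v \<in> P_class"
proof -
  let ?a = "crossing (pmeas v)"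
  note c = crossing_pmeas[OF v]
  have O: "(?a, 1) \<in> Omega" "(?a, -1) \<in> Omega"
    using c window by (auto simp: Omega_def)
  have "partial1 (dens (pmeas v)) (?a, -1) < partial1 (dens (pmeas v)) (?a, 1)"
    using slope_ge[of ?a] direction_bound[OF v, of ?a] c s_pos
    by (simp add: partial1_dens_pmeas[OF v] O abs_le_iff)
  then show ?thesis
    using pmeas_P_tilde[OF v] ex1_crossing[OF v] c window by (auto simp: P_class_def)
qed

text \<open>One \<open>\<epsilon>\<close> pays for the size of \<open>psi v\<close>, the other for
  that of its slope \<open>v\<close>. This keeps perturbed measures inside a given ball around
  \<open>P\<close>.\<close>

lemma dist_P_pmeas:
  assumes v: "v \<in> directions" and P: "P \<in> P_tilde" and f: "f = dens P"
  shows "dist_P P (pmeas v) \<le> 2 * \<epsilon>"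
proof -
  have ne: "Omega \<noteq> {}" by (auto simp: Omega_def)
  have "sup_norm (\<lambda>\<omega>. dens P \<omega> - dens (pmeas v) \<omega>) \<le> \<epsilon>"
    unfolding sup_norm_def
  proof (rule cSUP_least[OF ne])
    fix \<omega> assume "\<omega> \<in> Omega"
    then show "\<bar>dens P \<omega> - dens (pmeas v) \<omega>\<bar> \<le> \<epsilon>"
      using psi_bound[OF v, of "fst \<omega>"]
      by (auto simp: dens_pmeas[OF v] f[symmetric] pdens_def Omega_def abs_mult)
  qed
  moreover have "sup_norm (\<lambda>\<omega>. partial1 (dens P) \<omega> - partial1 (dens (pmeas v)) \<omega>) \<le> \<epsilon>"
    unfolding sup_norm_def
  proof (rule cSUP_least[OF ne])
    fix \<omega> assume "\<omega> \<in> Omega"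
    then show "\<bar>partial1 (dens P) \<omega> - partial1 (dens (pmeas v)) \<omega>\<bar> \<le> \<epsilon>"
      using direction_bound[OF v, of "fst \<omega>"]
      by (auto simp: partial1_dens_pmeas[OF v] f[symmetric] Omega_def abs_mult)
  qed
  ultimately show ?thesis
    by (simp add: dist_P_def)
qed

text \<open>The equations are zero sets of 1-Lipschitz functionals of \<open>v\<close> in the sup
  norm, and the last condition is a closed ball. Closedness makes \<open>Baire_closed\<close>
  applicable.\<close>

lemma closed_directions: "closed directions"
proof -
  have eq: "directions = (\<Inter>x\<in>- {l..u}. {v :: real \<Rightarrow>\<^sub>C real. apply_bcontfun v x = 0}) \<inter>
      {v :: real \<Rightarrow>\<^sub>C real. integral {0..1} (apply_bcontfun v) = 0} \<inter> cball 0 \<epsilon>"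
    by (auto simp: directions_def)
  have 1: "continuous_on UNIV (\<lambda>v :: real \<Rightarrow>\<^sub>C real. apply_bcontfun v x)" for x
    by (rule lipschitz_on_continuous_on[of 1], rule lipschitz_onI) (use dist_bounded in auto)
  have 2: "continuous_on UNIV (\<lambda>v :: real \<Rightarrow>\<^sub>C real. integral {0..1} (apply_bcontfun v))"
    by (rule lipschitz_on_continuous_on[of 1], rule lipschitz_onI)
      (use integral_dist_le[of 1] in \<open>auto simp: dist_real_def\<close>)
  show ?thesis
    unfolding eq by (intro closed_Int closed_INT ballI closed_Collect_eq 1 2 continuous_intros closed_cball)
qed

end

section \<open>Two elementary estimates\<close>

text \<open>The power is at most \<open>exp (n * x)\<close>. The form \<open>1 / (k^2 + 1)\<close>
  is chosen because \<open>1 - t \<le> exp (- t)\<close> at this \<open>t\<close> reads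
  \<open>k^2 / (k^2 + 1) \<le> exp (- t)\<close>, whose reciprocal is
  \<open>exp t \<le> 1 + 1 / k^2\<close>.\<close>

lemma sqrt_power_le:
  fixes x k :: real
  assumes "0 \<le> x" "0 < k" "real n * x \<le> 1 / (k\<^sup>2 + 1)"
  shows "sqrt ((1 + x) ^ n - 1) \<le> 1 / k"
proof -
  have "(1 + x) ^ n \<le> exp x ^ n"
    using assms by (intro power_mono exp_ge_add_one_self) auto
  also have "\<dots> = exp (real n * x)"
    by (simp add: exp_of_nat_mult)
  also have "\<dots> \<le> exp (1 / (k\<^sup>2 + 1))"
    using assms by simp
  also have "\<dots> \<le> 1 + 1 / k\<^sup>2"
  proof -
    have "1 + - (1 / (k\<^sup>2 + 1)) \<le> exp (- (1 / (k\<^sup>2 + 1)))"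
      by (rule exp_ge_add_one_self)
    moreover have "1 + - (1 / (k\<^sup>2 + 1)) = k\<^sup>2 / (k\<^sup>2 + 1)"
      using zero_less_power2[of k] by (simp add: field_simps add_pos_pos add_nonneg_eq_0_iff)
    ultimately have "k\<^sup>2 / (k\<^sup>2 + 1) \<le> inverse (exp (1 / (k\<^sup>2 + 1)))"
      by (simp add: exp_minus)
    moreover have "0 < k\<^sup>2 / (k\<^sup>2 + 1)"
      using assms by (simp add: add_pos_pos)
    ultimately have "exp (1 / (k\<^sup>2 + 1)) \<le> inverse (k\<^sup>2 / (k\<^sup>2 + 1))"
      by (metis inverse_inverse_eq le_imp_inverse_le)
    also have "\<dots> = 1 + 1 / k\<^sup>2"
      using assms by (simp add: field_simps)
    finally show ?thesis .
  qed
  finally have "(1 + x) ^ n - 1 \<le> (1 / k)\<^sup>2"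
    by (simp add: power_divide)
  then show ?thesis
    using assms by (intro real_le_lsqrt) auto
qed

text \<open>Squaring smooths the kink at 0, where the difference quotient is at most
  \<open>\<bar>h\<bar>\<close>. This makes the bump below continuously differentiable at the edge of
  its support.\<close>

lemma DERIV_max_zero_power2:
  "((\<lambda>y::real. (max 0 y)\<^sup>2) has_real_derivative 2 * max 0 y) (at y)"
proof (cases y "0::real" rule: linorder_cases)
  case less
  have "((\<lambda>y::real. 0) has_real_derivative 2 * max 0 y) (at y)"
    using less by simp
  then show ?thesis
    by (rule has_field_derivative_transform_within_open[of _ _ _ "{..<0}"]) (use less in auto)
next
  case greater
  have "((\<lambda>y::real. y\<^sup>2) has_real_derivative 2 * max 0 y) (at y)"
    using greater by (auto intro!: derivative_eq_intros)
  then show ?thesis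
    by (rule has_field_derivative_transform_within_open[of _ _ _ "{0<..}"]) (use greater in auto)
next
  case equal
  have "((\<lambda>h::real. (max 0 h)\<^sup>2 / h) \<longlongrightarrow> 0) (at 0)"
  proof (rule Lim_null_comparison)
    show "\<forall>\<^sub>F h::real in at 0. norm ((max 0 h)\<^sup>2 / h) \<le> \<bar>h\<bar>"
      by (intro always_eventually) (auto simp: max_def power2_eq_square)
    show "((\<lambda>h::real. \<bar>h\<bar>) \<longlongrightarrow> 0) (at 0)"
      by (auto intro!: tendsto_eq_intros)
  qed
  then show ?thesis
    using equal by (simp add: DERIV_def)
qed

section \<open>Chi-square divergence between perturbed measures\<close>

context crossing_window
begin

text \<open>\<open>R\<close> is the likelihood ratio; its default 1 covers zeros of
  \<open>pdens v\<close>, and the guard keeps \<open>R\<close> nonnegative even off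
  \<open>Omega\<close>, as \<open>PiM_density\<close> demands. Where the perturbations differ,
  \<open>pdens v\<close> is at least \<open>\<epsilon>\<close>, so each branch contributes at most
  the squared difference over \<open>\<epsilon>\<close>; the factor 2 counts the branches.\<close>

lemma pmeas_density:
  assumes v: "v \<in> directions" and w: "w \<in> directions"
  defines "R \<equiv> \<lambda>\<omega>. if 0 < pdens v \<omega> \<and> 0 \<le> pdens w \<omega> then pdens w \<omega> / pdens v \<omega> else 1"
  shows "pmeas w = density (pmeas v) R"
    and "(\<integral>\<^sup>+\<omega>. ennreal ((R \<omega> - 1)\<^sup>2) \<partial>pmeas v) \<le>
      ennreal (2 / \<epsilon> * integral {0..1} (\<lambda>x. (psi w x - psi v x)\<^sup>2))"
proof -
  have [measurable]: "R \<in> borel_measurable base_measure"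
    unfolding R_def by measurable
  \<comment> \<open>Inside the window the density is bounded below; outside it both perturbations
    vanish.\<close>
  have eq_or_pos: "pdens v (x, y) = pdens w (x, y) \<and> psi w x = psi v x \<or> \<epsilon> \<le> pdens v (x, y)"
    if "x \<in> {0..1}" "y \<in> {-1, 1}" for x y
  proof (cases "x \<in> {l..u}")
    case True
    then show ?thesis using pdens_ge[OF v True that(2)] by simp
  next
    case False
    then have "psi v x = 0" "psi w x = 0"
      using psi_outside[OF v that(1)] psi_outside[OF w that(1)] by auto
    then show ?thesis by (simp add: pdens_def)
  qed
  have mult: "pdens v (x, y) * R (x, y) = pdens w (x, y)"
    and chi: "pdens v (x, y) * (R (x, y) - 1)\<^sup>2 \<le> (psi w x - psi v x)\<^sup>2 / \<epsilon>"
    if xy: "x \<in> {0..1}" "y \<in> {-1, 1}" for x y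
  proof -
    have "(x, y) \<in> Omega" using xy by (auto simp: Omega_def)
    then have nn: "0 \<le> pdens v (x, y)" "0 \<le> pdens w (x, y)"
      using pdens_nonneg v w by blast+
    show "pdens v (x, y) * R (x, y) = pdens w (x, y)"
      using eq_or_pos[OF xy] nn eps_pos by (auto simp: R_def)
    show "pdens v (x, y) * (R (x, y) - 1)\<^sup>2 \<le> (psi w x - psi v x)\<^sup>2 / \<epsilon>"
    proof (cases "\<epsilon> \<le> pdens v (x, y)")
      case True
      then have pos: "0 < pdens v (x, y)" using eps_pos by simp
      have "R (x, y) - 1 = of_int y * (psi w x - psi v x) / pdens v (x, y)"
        using pos nn by (simp add: R_def pdens_def field_simps)
      then have "pdens v (x, y) * (R (x, y) - 1)\<^sup>2 = (psi w x - psi v x)\<^sup>2 / pdens v (x, y)"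
        using pos xy(2) by (auto simp: power2_eq_square)
      also have "\<dots> \<le> (psi w x - psi v x)\<^sup>2 / \<epsilon>"
        using True eps_pos by (intro divide_left_mono) auto
      finally show ?thesis .
    next
      case False
      \<comment> \<open>Both densities agree here, so \<open>R\<close> is 1 either as their quotient
        or by default.\<close>
      then have "R (x, y) = 1"
        using eq_or_pos[OF xy] by (auto simp: R_def)
      then show ?thesis using eps_pos by simp
    qed
  qed
  have R0: "0 \<le> R \<omega>" for \<omega>
    by (simp add: R_def)
  have "density (pmeas v) R = density base_measure (\<lambda>\<omega>. ennreal (pdens v \<omega>) * ennreal (R \<omega>))"
    unfolding pmeas_def by (rule density_density_eq) auto
  also have "\<dots> = pmeas w"
    unfolding pmeas_def
  proof (intro density_cong AE_I2)
    fix \<omega> assume \<omega>: "\<omega> \<in> space base_measure"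
    then obtain x y where "\<omega> = (x, y)" "x \<in> {0..1}" "y \<in> {-1, 1}"
      by (auto simp: space_base_measure Omega_def)
    then show "ennreal (pdens v \<omega>) * ennreal (R \<omega>) = ennreal (pdens w \<omega>)"
      using mult pdens_nonneg[OF v] \<omega> R0
      by (simp add: ennreal_mult''[symmetric] space_base_measure)
  qed auto
  finally show "pmeas w = density (pmeas v) R" by simp
  define J where "J = integral {0..1} (\<lambda>x. 2 / \<epsilon> * (psi w x - psi v x)\<^sup>2)"
  have J: "((\<lambda>x. 2 / \<epsilon> * (psi w x - psi v x)\<^sup>2) has_integral J) {0..1}"
    unfolding J_def
    by (intro integrable_integral integrable_continuous_interval continuous_intros psi_cont)
  have "(\<integral>\<^sup>+\<omega>. ennreal ((R \<omega> - 1)\<^sup>2) \<partial>pmeas v) =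
      (\<integral>\<^sup>+\<omega>. ennreal (pdens v \<omega>) * ennreal ((R \<omega> - 1)\<^sup>2) \<partial>base_measure)"
    unfolding pmeas_def by (rule nn_integral_density) auto
  also have "\<dots> = (\<integral>\<^sup>+x\<in>{0..1}. (ennreal (pdens v (x, 1)) * ennreal ((R (x, 1) - 1)\<^sup>2) +
      ennreal (pdens v (x, -1)) * ennreal ((R (x, -1) - 1)\<^sup>2)) \<partial>lborel)"
    by (rule nn_integral_base_measure) measurable
  also have "\<dots> \<le> (\<integral>\<^sup>+x. ennreal (indicator {0..1} x * (2 / \<epsilon> * (psi w x - psi v x)\<^sup>2)) \<partial>lborel)"
  proof (rule nn_integral_mono)
    fix x :: real
    show "(ennreal (pdens v (x, 1)) * ennreal ((R (x, 1) - 1)\<^sup>2) +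
        ennreal (pdens v (x, -1)) * ennreal ((R (x, -1) - 1)\<^sup>2)) * indicator {0..1} x
      \<le> ennreal (indicator {0..1} x * (2 / \<epsilon> * (psi w x - psi v x)\<^sup>2))"
    proof (cases "x \<in> {0..1}")
      case True
      then have "(x, 1) \<in> Omega" "(x, -1) \<in> Omega" by (auto simp: Omega_def)
      then have "0 \<le> pdens v (x, 1)" "0 \<le> pdens v (x, -1)"
        by (auto intro: pdens_nonneg[OF v])
      then have "(ennreal (pdens v (x, 1)) * ennreal ((R (x, 1) - 1)\<^sup>2) +
          ennreal (pdens v (x, -1)) * ennreal ((R (x, -1) - 1)\<^sup>2)) =
          ennreal (pdens v (x, 1) * (R (x, 1) - 1)\<^sup>2 + pdens v (x, -1) * (R (x, -1) - 1)\<^sup>2)"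
        by (simp add: ennreal_mult)
      also have "\<dots> \<le> ennreal (2 / \<epsilon> * (psi w x - psi v x)\<^sup>2)"
        using chi[OF True, of 1] chi[OF True, of "-1"] by (intro ennreal_leI) simp
      finally show ?thesis using True by simp
    qed simp
  qed
  also have "\<dots> = ennreal J"
    by (rule nn_integral_has_integral_lebesgue[OF _ J]) (use eps_pos in auto)
  finally show "(\<integral>\<^sup>+\<omega>. ennreal ((R \<omega> - 1)\<^sup>2) \<partial>pmeas v) \<le>
      ennreal (2 / \<epsilon> * integral {0..1} (\<lambda>x. (psi w x - psi v x)\<^sup>2))"
    by (simp add: J_def)
qed

lemma sets_pmeas [simp]: "sets (pmeas v) = sets base_measure"
  by (simp add: pmeas_def)

lemma space_PiM_pmeas: "space (PiM I (\<lambda>_. pmeas v)) = space (PiM I (\<lambda>_. base_measure))"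
  by (simp add: space_PiM pmeas_def)

lemma sets_PiM_pmeas: "sets (PiM I (\<lambda>_. pmeas v)) = sets (PiM I (\<lambda>_. base_measure))"
  by (rule sets_PiM_cong) auto

text \<open>\<open>k\<close> sets the tolerance. It is used with \<open>k = 4\<close> and
  \<open>k = 8\<close>, where the right-hand sides of the sample size condition are 1/17 and
  1/65.\<close>

lemma PiM_pmeas_diff:
  assumes v: "v \<in> directions" and w: "w \<in> directions"
    and A: "A \<in> sets (PiM {..<n} (\<lambda>_. base_measure))"
    and J: "2 / \<epsilon> * integral {0..1} (\<lambda>x. (psi w x - psi v x)\<^sup>2) \<le> \<kappa>"
    and k: "0 < k" "real n * \<kappa> \<le> 1 / (k\<^sup>2 + 1)"
  shows "\<bar>measure (PiM {..<n} (\<lambda>_. pmeas w)) A - measure (PiM {..<n} (\<lambda>_. pmeas v)) A\<bar> \<le> 1 / k"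
proof -
  define R where "R \<omega> = (if 0 < pdens v \<omega> \<and> 0 \<le> pdens w \<omega> then pdens w \<omega> / pdens v \<omega> else 1)" for \<omega>
  note R = pmeas_density[OF v w, folded R_def]
  have J0: "0 \<le> 2 / \<epsilon> * integral {0..1} (\<lambda>x. (psi w x - psi v x)\<^sup>2)"
    using eps_pos by (intro mult_nonneg_nonneg integral_nonneg integrable_continuous_interval
        continuous_intros psi_cont) auto
  then have \<kappa>0: "0 \<le> \<kappa>" using J by linarith
  have "\<bar>measure (PiM {..<n} (\<lambda>_. density (pmeas v) R)) A - measure (PiM {..<n} (\<lambda>_. pmeas v)) A\<bar>
      \<le> sqrt ((1 + \<kappa>) ^ card {..<n} - 1)"
  proof (rule PiM_density_diff_le)
    show "prob_space (pmeas v)" by (rule prob_pmeas[OF v])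
    show "prob_space (density (pmeas v) R)"
      unfolding R(1)[symmetric] by (rule prob_pmeas[OF w])
    have "R \<in> borel_measurable base_measure"
      unfolding R_def by measurable
    then show "R \<in> borel_measurable (pmeas v)"
      by (simp add: pmeas_def)
    show "(\<integral>\<^sup>+\<omega>. ennreal ((R \<omega> - 1)\<^sup>2) \<partial>pmeas v) \<le> ennreal \<kappa>"
      by (rule order_trans[OF R(2) ennreal_leI[OF J]])
    show "A \<in> sets (PiM {..<n} (\<lambda>_. pmeas v))"
      using A by (simp add: sets_PiM_pmeas)
  qed (auto simp: R_def \<kappa>0)
  also have "\<dots> \<le> 1 / k"
    using sqrt_power_le[OF \<kappa>0 k] by simp
  finally show ?thesis
    unfolding R(1)[symmetric] .
qed

section \<open>Excess prediction error of a threshold\<close>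

definition excess :: "(real \<Rightarrow>\<^sub>C real) \<Rightarrow> real \<Rightarrow> real" where
  "excess v \<alpha> = prediction_error (pmeas v) \<alpha> - prediction_error (pmeas v) (crossing (pmeas v))"

lemma integrable_gap: "0 \<le> a \<Longrightarrow> b \<le> 1 \<Longrightarrow> gap v integrable_on {a..b}"
  by (intro integrable_continuous_interval continuous_on_subset[OF gap_cont]) auto

lemma prediction_error_pmeas:
  "v \<in> directions \<Longrightarrow> prediction_error (pmeas v) \<alpha> =
    integral {0..1} (\<lambda>x. pdens v (x, -1)) + integral {0..max 0 (min 1 \<alpha>)} (gap v)"
  using prediction_error_density[OF C1_density_pmeas] by (simp add: gap_def[abs_def])

lemma excess_eq:
  assumes v: "v \<in> directions"
  shows "excess v \<alpha> = integral {0..max 0 (min 1 \<alpha>)} (gap v) - integral {0..crossing (pmeas v)} (gap v)"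
proof -
  have "max 0 (min 1 (crossing (pmeas v))) = crossing (pmeas v)"
    using crossing_pmeas[OF v] window by simp
  then show ?thesis
    by (simp add: excess_def prediction_error_pmeas[OF v])
qed

lemma excess_measurable:
  assumes v: "v \<in> directions"
  shows "excess v \<in> borel_measurable borel"
proof -
  have "continuous_on {0..1} (\<lambda>x. integral {0..x} (gap v))"
    by (rule indefinite_integral_continuous_1) (simp add: integrable_gap)
  then have "continuous_on UNIV (\<lambda>\<alpha>. integral {0..max 0 (min 1 \<alpha>)} (gap v))"
    by (rule continuous_on_compose2) (auto intro!: continuous_intros)
  then show ?thesis
    unfolding excess_eq[OF v, abs_def]
    by (intro borel_measurable_continuous_onI continuous_intros)
qed

lemma gap_nonneg:
  assumes v: "v \<in> directions" and x: "crossing (pmeas v) \<le> x" "x \<le> 1"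
  shows "0 \<le> gap v x"
proof (cases "x \<le> u")
  case True
  have "0 \<le> s * (x - crossing (pmeas v))" using s_pos x by simp
  also have "\<dots> \<le> gap v x"
    using gap_slope(1)[OF v, of "crossing (pmeas v)" x] crossing_pmeas[OF v] x True by simp
  finally show ?thesis .
next
  case False
  then show ?thesis using gap_right[OF v, of x] x by simp
qed

lemma gap_nonpos:
  assumes v: "v \<in> directions" and x: "0 \<le> x" "x \<le> crossing (pmeas v)"
  shows "gap v x \<le> 0"
proof (cases "l \<le> x")
  case True
  have "s * (crossing (pmeas v) - x) \<le> - gap v x"
    using gap_slope(1)[OF v, of x "crossing (pmeas v)"] crossing_pmeas[OF v] x True by simp
  moreover have "0 \<le> s * (crossing (pmeas v) - x)" using s_pos x by simp
  ultimately show ?thesis by simp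
next
  case False
  then show ?thesis using gap_left[OF v, of x] x by simp
qed

lemma integral_linear:
  fixes a b c :: real
  assumes "a \<le> b"
  shows "((\<lambda>x. s * (x - c)) has_integral s / 2 * (b - c)\<^sup>2 - s / 2 * (a - c)\<^sup>2) {a..b}"
  by (rule fundamental_theorem_of_calculus[OF assms])
    (auto intro!: derivative_eq_intros simp: has_real_derivative_iff_has_vector_derivative[symmetric])

text \<open>To the right of the crossing the gap lies above the line of slope \<open>s\<close> as
  far as \<open>m\<close> and is nonnegative beyond, so its integral is at least the area of a
  triangle. The intermediate point \<open>m\<close> in the window allows \<open>\<alpha>\<close>
  itself to lie outside it.\<close>

lemma excess_right:
  assumes v: "v \<in> directions" and m: "crossing (pmeas v) \<le> m" "m \<le> u" "m \<le> max 0 (min 1 \<alpha>)"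
  shows "s / 2 * (m - crossing (pmeas v))\<^sup>2 \<le> excess v \<alpha>"
proof -
  define a where "a = crossing (pmeas v)"
  define c where "c = max 0 (min 1 \<alpha>)"
  have a: "l < a" "a < u" "gap v a = 0" using crossing_pmeas[OF v] by (auto simp: a_def)
  have c: "c \<le> 1" "m \<le> c" using m by (auto simp: c_def)
  have m': "a \<le> m" "m \<le> u" using m by (auto simp: a_def)
  have "integral {0..c} (gap v) = integral {0..a} (gap v) + integral {a..c} (gap v)"
    by (rule Henstock_Kurzweil_Integration.integral_combine[symmetric])
      (use a c m' window in \<open>auto intro!: integrable_gap\<close>)
  moreover have "integral {a..c} (gap v) = integral {a..m} (gap v) + integral {m..c} (gap v)"
    by (rule Henstock_Kurzweil_Integration.integral_combine[symmetric])
      (use a c m' window in \<open>auto intro!: integrable_gap\<close>)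
  moreover have "0 \<le> integral {m..c} (gap v)"
    using a c m' window gap_nonneg[OF v]
    by (intro Henstock_Kurzweil_Integration.integral_nonneg integrable_gap) (auto simp: a_def)
  moreover have "s / 2 * (m - a)\<^sup>2 - s / 2 * (a - a)\<^sup>2 \<le> integral {a..m} (gap v)"
  proof (rule has_integral_le[OF integral_linear[OF m'(1), of a] integrable_integral])
    show "gap v integrable_on {a..m}" using a m' window by (intro integrable_gap) auto
    show "s * (x - a) \<le> gap v x" if "x \<in> {a..m}" for x
      using gap_slope(1)[OF v, of a x] a m' that by simp
  qed
  ultimately show ?thesis
    by (simp add: excess_eq[OF v] a_def[symmetric] c_def[symmetric])
qed

lemma excess_left:
  assumes v: "v \<in> directions" and m: "m \<le> crossing (pmeas v)" "l \<le> m" "max 0 (min 1 \<alpha>) \<le> m"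
  shows "s / 2 * (m - crossing (pmeas v))\<^sup>2 \<le> excess v \<alpha>"
proof -
  define a where "a = crossing (pmeas v)"
  define c where "c = max 0 (min 1 \<alpha>)"
  have a: "l < a" "a < u" "gap v a = 0" using crossing_pmeas[OF v] by (auto simp: a_def)
  have c: "0 \<le> c" "c \<le> m" using m by (auto simp: c_def)
  have m': "m \<le> a" "l \<le> m" using m by (auto simp: a_def)
  have "integral {0..a} (gap v) = integral {0..c} (gap v) + integral {c..a} (gap v)"
    by (rule Henstock_Kurzweil_Integration.integral_combine[symmetric])
      (use a c m' window in \<open>auto intro!: integrable_gap\<close>)
  moreover have "integral {c..a} (gap v) = integral {c..m} (gap v) + integral {m..a} (gap v)"
    by (rule Henstock_Kurzweil_Integration.integral_combine[symmetric])
      (use a c m' window in \<open>auto intro!: integrable_gap\<close>)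
  moreover have "integral {c..m} (gap v) \<le> 0"
    using a c m' window gap_nonpos[OF v] integral_le[of "gap v" "{c..m}" "\<lambda>_. 0"]
      integrable_const_ivl[of 0 c m] integrable_gap[of c m v] by (simp add: a_def)
  moreover have "integral {m..a} (gap v) \<le> s / 2 * (a - a)\<^sup>2 - s / 2 * (m - a)\<^sup>2"
  proof (rule has_integral_le[OF integrable_integral integral_linear[OF m'(1), of a]])
    show "gap v integrable_on {m..a}" using a m' window by (intro integrable_gap) auto
    show "gap v x \<le> s * (x - a)" if "x \<in> {m..a}" for x
      using gap_slope(1)[OF v, of x a] a m' that by (simp add: algebra_simps)
  qed
  ultimately show ?thesis
    by (simp add: excess_eq[OF v] a_def[symmetric] c_def[symmetric])
qed

lemma excess_nonneg:
  assumes v: "v \<in> directions"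
  shows "0 \<le> excess v \<alpha>"
  using excess_right[OF v, of "crossing (pmeas v)" \<alpha>] excess_left[OF v, of "crossing (pmeas v)" \<alpha>]
    crossing_pmeas[OF v] linear[of "crossing (pmeas v)" "max 0 (min 1 \<alpha>)"] by auto

lemma integral_gap_diff:
  assumes "0 \<le> x" "x \<le> 1"
  shows "\<bar>integral {0..x} (gap v) - integral {0..x} (gap w)\<bar> \<le> 2 * dist v w"
proof -
  have "integral {0..x} (gap v) - integral {0..x} (gap w) = integral {0..x} (\<lambda>t. gap v t - gap w t)"
    by (rule Henstock_Kurzweil_Integration.integral_diff[symmetric])
      (use assms in \<open>auto intro!: integrable_gap\<close>)
  moreover have "norm (integral {0..x} (\<lambda>t. gap v t - gap w t)) \<le> 2 * dist v w * (x - 0)"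
  proof (rule integral_bound)
    show "continuous_on {0..x} (\<lambda>t. gap v t - gap w t)"
      by (intro continuous_intros continuous_on_subset[OF gap_cont]) (use assms in auto)
    show "norm (gap v t - gap w t) \<le> 2 * dist v w" if "t \<in> {0..x}" for t
      using psi_dist_le[of t v w] that assms by (simp add: gap_eq)
  qed (use assms in auto)
  moreover have "2 * dist v w * x \<le> 2 * dist v w"
    using assms by (simp add: mult_left_le)
  ultimately show ?thesis by simp
qed

text \<open>Each of the two integrals in \<open>excess_eq\<close> moves by at most
  \<open>2 * dist v w\<close>. The two crossings need not be compared, since each minimises its own
  integral.\<close>

lemma excess_dist:
  assumes v: "v \<in> directions" and w: "w \<in> directions"
  shows "excess v \<alpha> \<le> excess w \<alpha> + 4 * dist v w"
proof -
  define c where "c = max 0 (min 1 \<alpha>)"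
  have c: "0 \<le> c" "c \<le> 1" by (auto simp: c_def)
  define a where "a = crossing (pmeas v)"
  define b where "b = crossing (pmeas w)"
  have ab: "0 \<le> a" "a \<le> 1" "0 \<le> b" "b \<le> 1"
    using crossing_pmeas[OF v] crossing_pmeas[OF w] window by (auto simp: a_def b_def)
  \<comment> \<open>For \<open>w\<close>, the threshold \<open>a\<close> is no better than its own
    crossing \<open>b\<close>, so \<open>a\<close> may replace \<open>b\<close> in the upper
    bound.\<close>
  have "0 \<le> excess w a" by (rule excess_nonneg[OF w])
  moreover have "max 0 (min 1 a) = a" using ab by simp
  ultimately have "0 \<le> integral {0..a} (gap w) - integral {0..b} (gap w)"
    by (simp add: excess_eq[OF w] b_def)
  then show ?thesis
    using integral_gap_diff[OF c, of v w] integral_gap_diff[OF ab(1,2), of v w]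
    by (simp add: excess_eq[OF v] excess_eq[OF w] abs_le_iff
        a_def[symmetric] b_def[symmetric] c_def[symmetric])
qed

end

subsection \<open>Two-point lower bound\<close>

text \<open>The scaling makes the derivative bounded by \<open>\<tau>\<close>, uniformly in the width \<open>w\<close>.\<close>

definition bump :: "real \<Rightarrow> real \<Rightarrow> real \<Rightarrow> real \<Rightarrow> real" where
  "bump \<tau> a w x = \<tau> / 4 * (max 0 (w\<^sup>2 - (x - a)\<^sup>2))\<^sup>2 / w ^ 3"

definition bump_deriv :: "real \<Rightarrow> real \<Rightarrow> real \<Rightarrow> real \<Rightarrow> real" where
  "bump_deriv \<tau> a w x = - \<tau> * (x - a) * max 0 (w\<^sup>2 - (x - a)\<^sup>2) / w ^ 3"

lemma DERIV_bump: "(bump \<tau> a w has_real_derivative bump_deriv \<tau> a w x) (at x)"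
proof -
  have "((\<lambda>x. w\<^sup>2 - (x - a)\<^sup>2) has_real_derivative - 2 * (x - a)) (at x)"
    by (auto intro!: derivative_eq_intros)
  from DERIV_chain2[OF DERIV_max_zero_power2 this]
  have *: "((\<lambda>x. (max 0 (w\<^sup>2 - (x - a)\<^sup>2))\<^sup>2) has_real_derivative
      2 * max 0 (w\<^sup>2 - (x - a)\<^sup>2) * (- 2 * (x - a))) (at x)" .
  have eq: "\<tau> / 4 * (2 * m * (- 2 * (x - a))) / w ^ 3 = - \<tau> * (x - a) * m / w ^ 3" for m
  proof -
    have "\<tau> / 4 * (2 * m * (- 2 * (x - a))) = - \<tau> * (x - a) * m"
      by (simp add: algebra_simps)
    then show ?thesis by (rule arg_cong)
  qed
  show ?thesis
    unfolding bump_def[abs_def] bump_deriv_def eq[symmetric]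
    by (intro DERIV_cdivide DERIV_cmult *)
qed

lemma bump_outside:
  assumes "w > 0" "x \<le> a - w \<or> a + w \<le> x"
  shows "bump \<tau> a w x = 0" "bump_deriv \<tau> a w x = 0"
proof -
  have "w\<^sup>2 \<le> (x - a)\<^sup>2"
    by (rule abs_le_square_iff[THEN iffD1]) (use assms in auto)
  then show "bump \<tau> a w x = 0" "bump_deriv \<tau> a w x = 0"
    by (auto simp: bump_def bump_deriv_def)
qed

lemma bump_center: "w > 0 \<Longrightarrow> bump \<tau> a w a = \<tau> * w / 4"
  by (simp add: bump_def power2_eq_square power3_eq_cube)

lemma bump_deriv_bound:
  assumes "0 < w" "0 < \<tau>"
  shows "\<bar>bump_deriv \<tau> a w x\<bar> \<le> \<tau>"
proof (cases "\<bar>x - a\<bar> \<le> w")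
  case True
  have "\<bar>x - a\<bar> * max 0 (w\<^sup>2 - (x - a)\<^sup>2) \<le> w * w\<^sup>2"
    using True assms by (intro mult_mono) auto
  then have "\<tau> * (\<bar>x - a\<bar> * max 0 (w\<^sup>2 - (x - a)\<^sup>2)) / w ^ 3 \<le> \<tau> * (w * w\<^sup>2) / w ^ 3"
    using assms by (intro divide_right_mono mult_left_mono) auto
  also have "\<dots> = \<tau>"
    using assms by (simp add: power2_eq_square power3_eq_cube)
  finally show ?thesis
    using assms by (simp add: bump_deriv_def abs_mult mult.assoc)
next
  case False
  then have "bump_deriv \<tau> a w x = 0"
    using assms by (intro bump_outside) auto
  then show ?thesis using assms by simp
qed

lemma bump_bound:
  assumes "0 < w" "0 < \<tau>"
  shows "(bump \<tau> a w x)\<^sup>2 \<le> (\<tau> * w / 4)\<^sup>2"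
proof (rule power_mono)
  have "(max 0 (w\<^sup>2 - (x - a)\<^sup>2))\<^sup>2 \<le> (w\<^sup>2)\<^sup>2"
    by (intro power_mono) auto
  then have "\<tau> / 4 * (max 0 (w\<^sup>2 - (x - a)\<^sup>2))\<^sup>2 / w ^ 3 \<le> \<tau> / 4 * (w\<^sup>2)\<^sup>2 / w ^ 3"
    using assms by (intro divide_right_mono mult_left_mono) auto
  then show "bump \<tau> a w x \<le> \<tau> * w / 4"
    using assms by (simp add: bump_def power2_eq_square power3_eq_cube)
  show "0 \<le> bump \<tau> a w x"
    using assms by (simp add: bump_def)
qed

lemma continuous_bump: "continuous_on A (bump \<tau> a w)"
  using DERIV_bump by (meson DERIV_isCont continuous_at_imp_continuous_on)

text \<open>Squared height \<open>(\<tau> * w / 4)^2\<close> times support length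
  \<open>2 * w\<close>. The resulting cube of \<open>w\<close> is what is balanced against the
  sample size.\<close>

lemma integral_bump_le:
  assumes "0 < w" "0 < \<tau>" "0 \<le> a - w" "a + w \<le> 1"
  shows "integral {0..1} (\<lambda>x. (bump \<tau> a w x)\<^sup>2) \<le> \<tau>\<^sup>2 * w ^ 3 / 8"
proof -
  let ?K = "(\<tau> * w / 4)\<^sup>2"
  have "((\<lambda>x. ?K) has_integral (a + w - (a - w)) *\<^sub>R ?K) {a - w..a + w}"
    using has_integral_const_real[of ?K "a - w" "a + w"] assms by simp
  then have K: "((\<lambda>x. if x \<in> {a - w..a + w} then ?K else 0) has_integral (a + w - (a - w)) *\<^sub>R ?K) {0..1}"
    by (subst has_integral_restrict) (use assms in auto)
  have J: "((\<lambda>x. (bump \<tau> a w x)\<^sup>2) has_integral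
      integral {0..1} (\<lambda>x. (bump \<tau> a w x)\<^sup>2)) {0..1}"
    by (intro integrable_integral integrable_continuous_interval continuous_intros continuous_bump)
  have "integral {0..1} (\<lambda>x. (bump \<tau> a w x)\<^sup>2) \<le> (a + w - (a - w)) *\<^sub>R ?K"
  proof (rule has_integral_le[OF J K])
    fix x :: real assume "x \<in> {0..1}"
    show "(bump \<tau> a w x)\<^sup>2 \<le> (if x \<in> {a - w..a + w} then ?K else 0)"
      using bump_bound[OF assms(1,2)] bump_outside(1)[OF assms(1), of x a] by auto
  qed
  also have "\<dots> = \<tau>\<^sup>2 * w ^ 3 / 8"
    by (simp add: power2_eq_square power3_eq_cube)
  finally show ?thesis .
qed

section \<open>Bump perturbations and separation of the excess\<close>

context crossing_window
begin

text \<open>The derivative of the bump is added to \<open>v\<close>. The spare \<open>\<tau>\<close>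
  in the norm absorbs it, and the total integral stays 0 because the bump is supported in the
  window.\<close>

lemma bump_direction:
  assumes v: "v \<in> directions" and \<tau>: "0 < \<tau>" "norm v + \<tau> \<le> \<epsilon>"
    and w: "0 < w" "l \<le> a - w" "a + w \<le> u"
  obtains v' where "v' \<in> directions" "dist v v' \<le> \<tau>"
    "\<And>x. x \<in> {0..1} \<Longrightarrow> psi v' x = psi v x + bump \<tau> a w x"
proof -
  have "continuous_on UNIV (bump_deriv \<tau> a w)"
    unfolding bump_deriv_def by (intro continuous_intros) (use w in auto)
  then have bc: "bump_deriv \<tau> a w \<in> bcontfun"
    by (rule bcontfun_normI[of _ \<tau>]) (use bump_deriv_bound[OF w(1) \<tau>(1)] in auto)
  define q where "q = Bcontfun (bump_deriv \<tau> a w)"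
  have q: "apply_bcontfun q = bump_deriv \<tau> a w"
    unfolding q_def by (rule Bcontfun_inverse[OF bc])
  have nq: "norm q \<le> \<tau>"
    by (rule norm_bound) (use bump_deriv_bound[OF w(1) \<tau>(1)] in \<open>simp add: q\<close>)
  have iq: "integral {0..x} (apply_bcontfun q) = bump \<tau> a w x" if "x \<in> {0..1}" for x
  proof -
    have "(bump_deriv \<tau> a w has_integral bump \<tau> a w x - bump \<tau> a w 0) {0..x}"
      by (rule fundamental_theorem_of_calculus)
        (use that DERIV_bump in \<open>auto simp: has_real_derivative_iff_has_vector_derivative[symmetric]
          intro: has_field_derivative_at_within\<close>)
    moreover have "bump \<tau> a w 0 = 0"
      by (rule bump_outside) (use w window in auto)
    ultimately show ?thesis by (simp add: q integral_unique)
  qed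
  have psi: "psi (v + q) x = psi v x + bump \<tau> a w x" if "x \<in> {0..1}" for x
  proof -
    have "integral {0..x} (apply_bcontfun (v + q)) =
        integral {0..x} (\<lambda>t. apply_bcontfun v t + apply_bcontfun q t)"
      by (simp add: plus_bcontfun.rep_eq)
    also have "\<dots> = integral {0..x} (apply_bcontfun v) + integral {0..x} (apply_bcontfun q)"
      by (rule Henstock_Kurzweil_Integration.integral_add) (rule integrable_direction)+
    finally show ?thesis using iq[OF that] by (simp add: psi_def)
  qed
  have "v + q \<in> directions"
    unfolding directions_def
  proof (intro CollectI conjI allI impI)
    fix x assume x: "x \<notin> {l..u}"
    then have "bump_deriv \<tau> a w x = 0"
      by (intro bump_outside) (use w in auto)
    then show "apply_bcontfun (v + q) x = 0"
      using v x by (simp add: directions_def plus_bcontfun.rep_eq q)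
  next
    have "bump \<tau> a w 1 = 0"
      by (rule bump_outside) (use w window in auto)
    then show "integral {0..1} (apply_bcontfun (v + q)) = 0"
      using psi[of 1] v by (simp add: psi_def directions_def)
  next
    show "norm (v + q) \<le> \<epsilon>"
      using norm_triangle_ineq[of v q] nq \<tau> by linarith
  qed
  moreover have "dist v (v + q) \<le> \<tau>"
    using nq by (simp add: dist_norm)
  ultimately show ?thesis using psi that by blast
qed

text \<open>Shrinking towards 0 frees norm \<open>t * \<epsilon>\<close> and moves \<open>v\<close>
  by no more than that; so a bump can be added even near directions on the boundary of the norm
  ball.\<close>

lemma scale_direction:
  assumes v: "v \<in> directions" and t: "0 \<le> t" "t \<le> 1"
  shows "(1 - t) *\<^sub>R v \<in> directions" "norm ((1 - t) *\<^sub>R v) \<le> (1 - t) * \<epsilon>"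
    "dist v ((1 - t) *\<^sub>R v) \<le> t * \<epsilon>"
proof -
  have nv: "norm v \<le> \<epsilon>" using v by (simp add: directions_def)
  show 1: "norm ((1 - t) *\<^sub>R v) \<le> (1 - t) * \<epsilon>"
    using nv t by (simp add: mult_left_mono)
  have "(1 - t) * \<epsilon> \<le> \<epsilon>" using t eps_pos by (simp add: mult_left_le_one_le)
  then show "(1 - t) *\<^sub>R v \<in> directions"
    using v 1 integral_cmul[of "{0..1}" "1 - t" "apply_bcontfun v"]
    by (auto simp: directions_def scaleR_bcontfun.rep_eq)
  have "v - (1 - t) *\<^sub>R v = t *\<^sub>R v"
    by (simp add: algebra_simps)
  then show "dist v ((1 - t) *\<^sub>R v) \<le> t * \<epsilon>"
    using nv t by (simp add: dist_norm mult_left_mono)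
qed

lemma S_pos: "0 < S"
  using slope_ge[of l] slope_le[of l] s_pos eps_pos window by simp

text \<open>At the old crossing the new gap is \<open>\<tau> * w / 2\<close>; since its slope is at
  most \<open>S\<close>, the crossing moves left by at least \<open>\<tau> * w / (2 * S)\<close>.
  Every threshold is at least half that distance away from one of the crossings, and the quadratic
  lower bound on the excess applies there.\<close>

lemma two_point:
  assumes v: "v \<in> directions" and v': "v' \<in> directions" and \<tau>: "0 < \<tau>" and w: "0 < w"
    and psi: "\<And>x. x \<in> {0..1} \<Longrightarrow> psi v' x = psi v x + bump \<tau> (crossing (pmeas v)) w x"
    and b: "b < s * \<tau>\<^sup>2 * w\<^sup>2 / (32 * S\<^sup>2)"
  shows "b < excess v \<alpha> \<or> b < excess v' \<alpha>"
proof -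
  define a where "a = crossing (pmeas v)"
  define a' where "a' = crossing (pmeas v')"
  have a: "l < a" "a < u" "gap v a = 0" using crossing_pmeas[OF v] by (auto simp: a_def)
  have a': "l < a'" "a' < u" "gap v' a' = 0" using crossing_pmeas[OF v'] by (auto simp: a'_def)
  have "psi v' a = psi v a + \<tau> * w / 4"
    using psi[of a] a window bump_center[OF w] by (simp add: a_def)
  then have ga: "gap v' a = \<tau> * w / 2"
    using a(3) by (simp add: gap_eq)
  then have "0 < gap v' a" using mult_pos_pos[OF \<tau> w] by linarith
  have "a' \<le> a"
  proof (rule ccontr)
    assume "\<not> a' \<le> a"
    then have "s * (a' - a) \<le> gap v' a' - gap v' a"
      using a a' by (intro gap_slope(1)[OF v']) auto
    moreover have "0 < s * (a' - a)" using s_pos \<open>\<not> a' \<le> a\<close> by simp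
    ultimately show False using \<open>0 < gap v' a\<close> a'(3) by simp
  qed
  then have "\<tau> * w / 2 \<le> S * (a - a')"
    using gap_slope(2)[OF v', of a' a] a a' ga by simp
  then have D: "\<tau> * w / (4 * S) \<le> (a - a') / 2"
    using S_pos by (simp add: field_simps)
  have "b < s / 2 * (\<tau> * w / (4 * S))\<^sup>2"
    using b by (simp add: power_mult_distrib power_divide)
  also have "\<dots> \<le> s / 2 * ((a - a') / 2)\<^sup>2"
    using D s_pos S_pos \<tau> w by (intro mult_left_mono power_mono) auto
  finally have b': "b < s / 2 * ((a - a') / 2)\<^sup>2" .
  \<comment> \<open>The midpoint decides: thresholds to its right are bad for \<open>v'\<close>,
    those to its left for \<open>v\<close>.\<close>
  define m where "m = (a + a') / 2"
  have m: "a' \<le> m" "m \<le> a" "l \<le> m" "m \<le> u" using \<open>a' \<le> a\<close> a a' by (auto simp: m_def)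
  have "m - a' = (a - a') / 2" "m - a = - ((a - a') / 2)" by (auto simp: m_def field_simps)
  then have sq: "(m - a')\<^sup>2 = ((a - a') / 2)\<^sup>2" "(m - a)\<^sup>2 = ((a - a') / 2)\<^sup>2"
    by (auto simp only: power2_minus)
  show ?thesis
  proof (cases "m \<le> max 0 (min 1 \<alpha>)")
    case True
    then show ?thesis
      using less_le_trans[OF b'[folded sq(1)] excess_right[OF v', folded a'_def, OF m(1,4)]] by blast
  next
    case False
    then have "max 0 (min 1 \<alpha>) \<le> m" by linarith
    then show ?thesis
      using less_le_trans[OF b'[folded sq(2)] excess_left[OF v, folded a_def, OF m(2,3)]] by blast
  qed
qed


section \<open>Failure probabilities of estimators\<close>

definition failure :: "(real \<Rightarrow>\<^sub>C real) \<Rightarrow> nat \<Rightarrow> ((nat \<Rightarrow> real \<times> int) \<Rightarrow> real) \<Rightarrow> real \<Rightarrow> real" where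
  "failure v n g b = measure (PiM {..<n} (\<lambda>_. pmeas v))
    {\<omega> \<in> space (PiM {..<n} (\<lambda>_. pmeas v)). b < excess v (g \<omega>)}"

lemma failure_set:
  assumes v: "v \<in> directions" and g: "estimator n g"
  shows "{\<omega> \<in> space (PiM {..<n} (\<lambda>_. pmeas w)). b < excess v (g \<omega>)}
    \<in> sets (PiM {..<n} (\<lambda>_. base_measure))"
proof -
  have [measurable]: "g \<in> borel_measurable (PiM {..<n} (\<lambda>_. base_measure))"
    using g by (simp add: estimator_def)
  note [measurable] = excess_measurable[OF v]
  show ?thesis
    unfolding space_PiM_pmeas by measurable
qed

text \<open>By \<open>sep\<close> the two failure events cover the sample space, so their
  probabilities under \<open>v\<close> sum to at least 1. Measuring the second under
  \<open>v'\<close> costs at most 1/4, since 17 is \<open>4^2 + 1\<close>; one of the failures thus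
  has at least half of 3/4.\<close>

lemma two_point_failure:
  assumes v: "v \<in> directions" and v': "v' \<in> directions" and g: "estimator n g"
    and sep: "\<And>\<alpha>. b < excess v \<alpha> \<or> b < excess v' \<alpha>"
    and J: "2 / \<epsilon> * integral {0..1} (\<lambda>x. (psi v' x - psi v x)\<^sup>2) \<le> \<kappa>" "real n * \<kappa> \<le> 1 / 17"
  shows "3 / 8 \<le> failure v n g b \<or> 3 / 8 \<le> failure v' n g b"
proof -
  let ?M = "PiM {..<n} (\<lambda>_. pmeas v)" and ?M' = "PiM {..<n} (\<lambda>_. pmeas v')"
  define A where "A w = {\<omega> \<in> space (PiM {..<n} (\<lambda>_. base_measure)). b < excess w (g \<omega>)}" for w
  have Am: "A w \<in> sets (PiM {..<n} (\<lambda>_. base_measure))" if "w \<in> directions" for w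
    using failure_set[OF that g, of w b] by (simp add: A_def space_PiM_pmeas)
  interpret M: prob_space ?M by (intro prob_space_PiM prob_pmeas v)
  have "\<bar>measure ?M' (A v') - measure ?M (A v')\<bar> \<le> 1 / 4"
    using J by (intro PiM_pmeas_diff[OF v v' Am[OF v'] J(1)]) auto
  moreover have "A v \<union> A v' = space ?M"
    using sep by (auto simp: A_def space_PiM_pmeas)
  then have "1 \<le> measure ?M (A v) + measure ?M (A v')"
    using measure_Un_le[of "A v" ?M "A v'"] Am v v' M.prob_space
    by (simp add: sets_PiM_pmeas)
  moreover have "failure v n g b = measure ?M (A v)" "failure v' n g b = measure ?M' (A v')"
    by (simp_all add: failure_def A_def space_PiM_pmeas)
  ultimately show ?thesis by linarith
qed

text \<open>Passing to a nearby \<open>w\<close> costs twice: at most 1/8 in probability through the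
  change of law, and at most \<open>b\<close> in the threshold through
  \<open>excess_dist\<close>.\<close>

lemma failure_robust:
  assumes v: "v \<in> directions" and g: "estimator n g" and n: "1 \<le> n" and b: "0 < b"
    and fail: "3 / 8 \<le> failure v n g (2 * b)"
  shows "\<exists>r>0. \<forall>w\<in>directions. dist v w < r \<longrightarrow> 1 / 4 \<le> failure w n g b"
proof -
  \<comment> \<open>\<open>b / 4\<close> answers the factor 4 of \<open>excess_dist\<close>. The
    root makes the chi-square bound \<open>2 / \<epsilon> * (dist v w)^2\<close> at most
    \<open>1 / (65 * n)\<close>, the case \<open>k = 8\<close>.\<close>
  define r where "r = min (b / 4) (sqrt (\<epsilon> / (130 * real n)))"
  have "0 < r" using b eps_pos n by (simp add: r_def)
  moreover have "1 / 4 \<le> failure w n g b" if w: "w \<in> directions" and d: "dist v w < r" for w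
  proof -
    let ?M = "PiM {..<n} (\<lambda>_. pmeas v)" and ?M' = "PiM {..<n} (\<lambda>_. pmeas w)"
    let ?A = "{\<omega> \<in> space ?M. 2 * b < excess v (g \<omega>)}"
    let ?B = "{\<omega> \<in> space ?M'. b < excess w (g \<omega>)}"
    interpret M': prob_space ?M' by (intro prob_space_PiM prob_pmeas w)
    have d2: "(dist v w)\<^sup>2 \<le> \<epsilon> / (130 * real n)"
    proof -
      have "(dist v w)\<^sup>2 \<le> (sqrt (\<epsilon> / (130 * real n)))\<^sup>2"
        using d by (intro power_mono) (auto simp: r_def)
      then show ?thesis using eps_pos by simp
    qed
    have "integral {0..1} (\<lambda>x. (psi w x - psi v x)\<^sup>2) \<le> integral {0..1} (\<lambda>x::real. (dist v w)\<^sup>2)"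
    proof (rule integral_le)
      fix x :: real assume "x \<in> {0..1}"
      then show "(psi w x - psi v x)\<^sup>2 \<le> (dist v w)\<^sup>2"
        using psi_dist_le[of x w v] by (simp add: abs_le_square_iff[symmetric] dist_commute)
    qed (auto intro!: integrable_continuous_interval continuous_intros psi_cont)
    then have "2 / \<epsilon> * integral {0..1} (\<lambda>x. (psi w x - psi v x)\<^sup>2) \<le> 2 / \<epsilon> * (\<epsilon> / (130 * real n))"
      using d2 eps_pos by (intro mult_left_mono) auto
    also have "\<dots> = 1 / (65 * real n)"
      using eps_pos by simp
    finally have "\<bar>measure ?M' ?A - measure ?M ?A\<bar> \<le> 1 / 8"
      using n by (intro PiM_pmeas_diff[OF v w failure_set[OF v g]]) auto
    moreover have "measure ?M' ?A \<le> measure ?M' ?B"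
    proof (rule M'.finite_measure_mono)
      show "?B \<in> sets ?M'"
        using failure_set[OF w g] by (simp add: sets_PiM_pmeas)
      have "4 * dist v w \<le> b" using d by (simp add: r_def)
      then show "?A \<subseteq> ?B"
        using excess_dist[OF v w] by (auto simp: space_PiM_pmeas) (smt (verit))
    qed
    ultimately show ?thesis
      using fail unfolding failure_def by linarith
  qed
  ultimately show ?thesis by blast
qed

lemma failure_dense:
  fixes \<beta> :: "nat \<Rightarrow> real"
  assumes lim: "filterlim (\<lambda>n. real n powr (-1/3) * \<beta> n) at_top sequentially"
    and g: "\<And>n. 1 \<le> n \<Longrightarrow> estimator n (g n)"
    and v: "v \<in> directions" and \<delta>: "0 < \<delta>"
  shows "\<exists>v'\<in>directions. dist v v' < \<delta> \<and> (\<exists>r>0. \<forall>w\<in>directions. dist v' w < r \<longrightarrow>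
    (\<exists>n\<ge>N. 1 / 4 \<le> failure w n (g n) (1 / (\<beta> n)\<^sup>2)))"
proof -
  \<comment> \<open>Shrinking and adding the bump each move by at most
    \<open>\<tau> = t * \<epsilon> \<le> \<delta> / 4\<close>, so both candidates stay within
    \<open>\<delta>\<close> of \<open>v\<close>.\<close>
  define t where "t = min 1 (\<delta> / (4 * \<epsilon>))"
  define \<tau> where "\<tau> = t * \<epsilon>"
  have t: "0 < t" "t \<le> 1" using \<delta> eps_pos by (auto simp: t_def)
  have \<tau>: "0 < \<tau>" "\<tau> \<le> \<delta> / 4"
  proof -
    show "0 < \<tau>" using t eps_pos by (simp add: \<tau>_def)
    have "t * \<epsilon> \<le> \<delta> / (4 * \<epsilon>) * \<epsilon>"
      using eps_pos by (intro mult_right_mono) (auto simp: t_def)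
    then show "\<tau> \<le> \<delta> / 4" using eps_pos by (simp add: \<tau>_def)
  qed
  define v1 where "v1 = (1 - t) *\<^sub>R v"
  have v1: "v1 \<in> directions" "norm v1 + \<tau> \<le> \<epsilon>" "dist v v1 \<le> \<tau>"
    using scale_direction[OF v, of t] t by (auto simp: v1_def \<tau>_def algebra_simps)
  define a where "a = crossing (pmeas v1)"
  have a: "l < a" "a < u" using crossing_pmeas[OF v1(1)] by (auto simp: a_def)
  \<comment> \<open>The width \<open>w = c / \<beta> n\<close> makes the bound of \<open>two_point\<close> equal to \<open>81 / 32 > 2\<close> times \<open>1 / (\<beta> n)\<^sup>2\<close>.\<close>
  define c where "c = 9 * S / (\<tau> * sqrt s)"
  have c: "0 < c" using S_pos \<tau> s_pos by (simp add: c_def)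
  \<comment> \<open>The chi-square bound for a bump of width \<open>c / \<beta> n\<close> is
    \<open>C / (\<beta> n)^3\<close>.\<close>
  define C where "C = 2 / \<epsilon> * (\<tau>\<^sup>2 * c ^ 3 / 8)"
  have C: "0 < C" using eps_pos \<tau> c by (simp add: C_def)
  define h where "h = min (a - l) (u - a)"
  have h: "0 < h" using a by (simp add: h_def)
  \<comment> \<open>The entry 1 gives \<open>K \<le> K^3\<close> and positivity of
    \<open>\<beta> n\<close>, \<open>c / h\<close> makes the bump fit into the window, and
    \<open>17 * C\<close> makes the two laws close. All depend on \<open>v1\<close> but not on
    \<open>n\<close>.\<close>
  define K where "K = Max {1, c / h, 17 * C}"
  have K: "1 \<le> K" "c / h \<le> K" "17 * C \<le> K" by (auto simp: K_def)
  have "\<forall>\<^sub>F n in sequentially. K \<le> real n powr (-1/3) * \<beta> n"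
    using lim by (simp add: filterlim_at_top)
  \<comment> \<open>Estimators are given from index 1 on, hence \<open>max 1 N\<close>.\<close>
  then have "\<forall>\<^sub>F n in sequentially. K \<le> real n powr (-1/3) * \<beta> n \<and> max 1 N \<le> n"
    using eventually_ge_at_top[of "max 1 N"] by (rule eventually_conj)
  then obtain n where n: "K \<le> real n powr (-1/3) * \<beta> n" "1 \<le> n" "N \<le> n"
    by (auto simp: eventually_sequentially)
  define r where "r = real n powr (1/3)"
  have r: "1 \<le> r" "r ^ 3 = real n"
    using n ge_one_powr_ge_zero[of "real n" "1/3"] by (simp_all add: r_def powr_power)
  have "r * K \<le> r * (real n powr (-1/3) * \<beta> n)"
    using r n by (intro mult_left_mono) auto
  also have "\<dots> = \<beta> n"
    using n by (simp add: r_def powr_add[symmetric] mult.assoc[symmetric])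
  finally have rK: "r * K \<le> \<beta> n" .
  moreover have "1 * K \<le> r * K" using r K by (intro mult_right_mono) auto
  ultimately have \<beta>: "K \<le> \<beta> n" "0 < \<beta> n" using K by linarith+
  define w where "w = c / \<beta> n"
  have w: "0 < w" using c \<beta> by (simp add: w_def)
  have "c \<le> h * \<beta> n"
  proof -
    have "c / h \<le> \<beta> n" using K \<beta> by simp
    then show ?thesis using h by (simp add: field_simps)
  qed
  then have "w \<le> h" using \<beta> by (simp add: w_def field_simps)
  then have lw: "l \<le> a - w" "a + w \<le> u" by (auto simp: h_def)
  obtain v2 where v2: "v2 \<in> directions" "dist v1 v2 \<le> \<tau>"
    "\<And>x. x \<in> {0..1} \<Longrightarrow> psi v2 x = psi v1 x + bump \<tau> a w x"
    using bump_direction[OF v1(1) \<tau>(1) v1(2) w lw] by blast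
  have sep: "2 * (1 / (\<beta> n)\<^sup>2) < excess v1 \<alpha> \<or> 2 * (1 / (\<beta> n)\<^sup>2) < excess v2 \<alpha>" for \<alpha>
  proof (rule two_point[OF v1(1) v2(1) \<tau>(1) w v2(3)[unfolded a_def]])
    have "s * \<tau>\<^sup>2 * w\<^sup>2 / (32 * S\<^sup>2) = 81 / 32 * (1 / (\<beta> n)\<^sup>2)"
      using s_pos S_pos \<tau> \<beta> by (simp add: w_def c_def power_mult_distrib power_divide)
    moreover have "0 < 1 / (\<beta> n)\<^sup>2" using \<beta> by simp
    ultimately show "2 * (1 / (\<beta> n)\<^sup>2) < s * \<tau>\<^sup>2 * w\<^sup>2 / (32 * S\<^sup>2)"
      by linarith
  qed auto
  have "integral {0..1} (\<lambda>x. (psi v2 x - psi v1 x)\<^sup>2) = integral {0..1} (\<lambda>x. (bump \<tau> a w x)\<^sup>2)"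
    by (rule Henstock_Kurzweil_Integration.integral_cong) (simp add: v2(3))
  also have "\<dots> \<le> \<tau>\<^sup>2 * w ^ 3 / 8"
    using lw window by (intro integral_bump_le w \<tau>) auto
  finally have "2 / \<epsilon> * integral {0..1} (\<lambda>x. (psi v2 x - psi v1 x)\<^sup>2) \<le> 2 / \<epsilon> * (\<tau>\<^sup>2 * w ^ 3 / 8)"
    using eps_pos by (intro mult_left_mono) auto
  also have "\<dots> = C / \<beta> n ^ 3"
    by (simp add: C_def w_def power_divide)
  finally have J: "2 / \<epsilon> * integral {0..1} (\<lambda>x. (psi v2 x - psi v1 x)\<^sup>2) \<le> C / \<beta> n ^ 3" .
  have nC: "real n * (C / \<beta> n ^ 3) \<le> 1 / 17"
  proof -
    have "real n * K \<le> real n * K ^ 3"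
      using K power_increasing[of 1 3 K] by (intro mult_left_mono) auto
    also have "\<dots> = (r * K) ^ 3"
      by (simp add: power_mult_distrib r)
    also have "\<dots> \<le> \<beta> n ^ 3"
      using rK r K by (intro power_mono) auto
    finally have "real n * K \<le> \<beta> n ^ 3" .
    moreover have "real n * (17 * C) \<le> real n * K"
      using K by (intro mult_left_mono) auto
    ultimately show ?thesis using \<beta> by (simp add: field_simps)
  qed
  \<comment> \<open>Which of the two measures is bad depends on the estimator; either serves, as
    both are close to \<open>v\<close>.\<close>
  have "\<exists>v'\<in>{v1, v2}. 3 / 8 \<le> failure v' n (g n) (2 * (1 / (\<beta> n)\<^sup>2))"
    using two_point_failure[OF v1(1) v2(1) g[OF n(2)] sep J nC] by blast
  then obtain v' where v': "v' \<in> {v1, v2}" "3 / 8 \<le> failure v' n (g n) (2 * (1 / (\<beta> n)\<^sup>2))"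
    by blast
  have v'd: "v' \<in> directions" using v' v1 v2 by auto
  have "\<exists>r>0. \<forall>w\<in>directions. dist v' w < r \<longrightarrow> 1 / 4 \<le> failure w n (g n) (1 / (\<beta> n)\<^sup>2)"
    by (rule failure_robust[OF v'd g[OF n(2)] n(2) _ v'(2)]) (use \<beta> in simp)
  then have "\<exists>r>0. \<forall>w\<in>directions. dist v' w < r \<longrightarrow>
      (\<exists>n\<ge>N. 1 / 4 \<le> failure w n (g n) (1 / (\<beta> n)\<^sup>2))"
    using n(3) by blast
  moreover have "dist v v' < \<delta>"
    using v' v1(3) v2(2) \<tau> \<delta> dist_triangle[of v v2 v1] by auto
  ultimately show ?thesis using v'd by blast
qed

lemma failure_infinitely_often:
  fixes \<beta> :: "nat \<Rightarrow> real"
  assumes lim: "filterlim (\<lambda>n. real n powr (-1/3) * \<beta> n) at_top sequentially"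
    and g: "\<And>n. 1 \<le> n \<Longrightarrow> estimator n (g n)"
  shows "\<exists>v\<in>directions. \<forall>N. \<exists>n\<ge>N. 1 / 4 \<le> failure v n (g n) (1 / (\<beta> n)\<^sup>2)"
proof (rule Baire_closed[OF closed_directions])
  have "0 \<in> directions"
    using eps_pos by (simp add: directions_def)
  then show "directions \<noteq> {}" by blast
qed (rule failure_dense[OF assms])

end

section \<open>Existence of a window around the crossing\<close>

lemma crossing_window_ex:
  assumes P: "P \<in> P_class" and \<rho>: "0 < \<rho>"
  obtains l u s S \<epsilon> where "crossing_window (dens P) l u s S \<epsilon>" "2 * \<epsilon> < \<rho>"
proof -
  define f where "f = dens P"
  define a where "a = crossing P"
  define g where "g x = f (x, 1) - f (x, -1)" for x
  define g' where "g' x = partial1 f (x, 1) - partial1 f (x, -1)" for x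
  have Pt: "P \<in> P_tilde" and ex1: "\<exists>!a. is_crossing P a" and a01: "0 < a" "a < 1"
    and g'a: "0 < g' a"
    using P by (auto simp: P_class_def a_def g'_def f_def)
  have C1: "C1_Omega f" and nonneg: "\<And>\<omega>. \<omega> \<in> Omega \<Longrightarrow> 0 \<le> f \<omega>"
    and P_eq: "P = density base_measure (\<lambda>\<omega>. ennreal (f \<omega>))"
    using is_C1_density_dens[OF Pt] by (auto simp: is_C1_density_def f_def)
  have "is_crossing P a"
    unfolding a_def crossing_def by (rule theI'[OF ex1])
  then have ga: "g a = 0" by (simp add: is_crossing_def g_def f_def)
  have uniq: "x = a" if "x \<in> {0..1}" "g x = 0" for x
    using ex1 \<open>is_crossing P a\<close> that by (auto simp: is_crossing_def g_def f_def)
  have fcont: "continuous_on {0..1} (\<lambda>x. f (x, y))" if "y \<in> {-1, 1}" for y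
    by (rule C1_Omega_cont[OF C1 that])
  have gcont: "continuous_on {0..1} g"
    unfolding g_def[abs_def] by (intro continuous_intros fcont) auto
  have g'cont: "continuous_on {0..1} g'"
    unfolding g'_def[abs_def] using C1 by (intro continuous_intros) (auto simp: C1_Omega_def)
  have dev: "((\<lambda>t. f (t, y)) has_real_derivative partial1 f (x, y)) (at x)"
    if "0 < x" "x < 1" "y \<in> {-1, 1}" for x y
    using C1_Omega_deriv[OF C1, of x y] that at_within_Icc_at[of 0 x 1]
    by (simp add: has_real_derivative_iff_has_vector_derivative)
  have gdev: "(g has_real_derivative g' x) (at x)" if "0 < x" "x < 1" for x
    unfolding g_def[abs_def] g'_def by (intro DERIV_diff dev that) auto
  have fpos: "0 < f (a, y)" if "y \<in> {-1, 1}" for y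
  proof (rule ccontr)
    assume "\<not> 0 < f (a, y)"
    moreover have "0 \<le> f (a, 1)" "0 \<le> f (a, -1)"
      using a01 by (auto intro!: nonneg simp: Omega_def)
    moreover have "f (a, 1) = f (a, -1)" using ga by (simp add: g_def)
    ultimately have z: "f (a, 1) = 0" "f (a, -1) = 0" using that by auto
    \<comment> \<open>A nonnegative branch that vanishes at the interior point \<open>a\<close> has
      a minimum there; two zero slopes contradict the positive slope of the difference.\<close>
    have "partial1 f (a, y') = 0" if y': "y' \<in> {-1, 1}" for y'
    proof (rule DERIV_local_min[OF dev[OF a01 y']])
      show "0 < min a (1 - a)" using a01 by simp
      show "\<forall>x. \<bar>a - x\<bar> < min a (1 - a) \<longrightarrow> f (a, y') \<le> f (x, y')"
      proof (intro allI impI)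
        fix x assume "\<bar>a - x\<bar> < min a (1 - a)"
        then have "(x, y') \<in> Omega" using y' by (auto simp: Omega_def)
        moreover have "f (a, y') = 0" using z y' by auto
        ultimately show "f (a, y') \<le> f (x, y')" using nonneg by simp
      qed
    qed
    then show False using g'a by (simp add: g'_def)
  qed
  define m where "m = f (a, 1) / 2"
  have m: "0 < m" using fpos[of 1] by (simp add: m_def)
  have fa: "f (a, y) = 2 * m" if "y \<in> {-1, 1}" for y
    using that ga by (auto simp: m_def g_def)
  have near: "\<forall>\<^sub>F x in nhds a. P' (h x)"
    if h: "continuous_on {0..1} h" and P': "open {z::real. P' z}" "P' (h a)" for h P'
  proof -
    have "isCont h a"
      using h a01 by (intro continuous_on_interior[OF h]) (simp add: interior_atLeastAtMost_real)
    then have "(h \<longlongrightarrow> h a) (nhds a)"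
      unfolding isCont_def by (simp only: tendsto_at_iff_tendsto_nhds)
    from topological_tendstoD[OF this P'(1)] show ?thesis
      using P'(2) by simp
  qed
  have "\<forall>\<^sub>F x in nhds a. m < f (x, 1) \<and> m < f (x, -1) \<and>
      g' a / 2 < g' x \<and> g' x < 2 * g' a \<and> 0 < x \<and> x < 1"
    using g'a m a01
    by (intro eventually_conj near[where P' = "\<lambda>z. m < z"] near[where P' = "\<lambda>z. g' a / 2 < z"]
        near[where P' = "\<lambda>z. z < 2 * g' a"] fcont g'cont eventually_nhds_in_open
        near[where P' = "\<lambda>z. 0 < z" and h = "\<lambda>z. z"] near[where P' = "\<lambda>z. z < 1" and h = "\<lambda>z. z"])
      (auto simp: fa intro!: open_Collect_less continuous_intros)
  then obtain d where d: "0 < d" and near_a: "\<And>x. dist x a < d \<Longrightarrow>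
      m < f (x, 1) \<and> m < f (x, -1) \<and> g' a / 2 < g' x \<and> g' x < 2 * g' a \<and> 0 < x \<and> x < 1"
    unfolding eventually_nhds_metric by blast
  \<comment> \<open>Half the radius, so that the closed window lies in the open ball.\<close>
  define l where "l = a - d / 2"
  define u where "u = a + d / 2"
  have lu: "l < a" "a < u" using d by (auto simp: l_def u_def)
  have win: "m < f (x, 1) \<and> m < f (x, -1) \<and> g' a / 2 < g' x \<and> g' x < 2 * g' a \<and> 0 < x \<and> x < 1"
    if "x \<in> {l..u}" for x
  proof (rule near_a)
    show "dist x a < d" using that d by (auto simp: l_def u_def dist_real_def)
  qed
  have gl: "g l < 0"
  proof -
    have "g l < g a"
    proof (rule DERIV_pos_imp_increasing[OF lu(1)])
      fix x assume "l \<le> x" "x \<le> a"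
      then have "x \<in> {l..u}" using lu by simp
      then show "\<exists>y. (g has_real_derivative y) (at x) \<and> 0 < y"
        using win[of x] gdev[of x] g'a by (intro exI[of _ "g' x"]) auto
    qed
    then show ?thesis by (simp add: ga)
  qed
  have gu: "0 < g u"
  proof -
    have "g a < g u"
    proof (rule DERIV_pos_imp_increasing[OF lu(2)])
      fix x assume "a \<le> x" "x \<le> u"
      then have "x \<in> {l..u}" using lu by simp
      then show "\<exists>y. (g has_real_derivative y) (at x) \<and> 0 < y"
        using win[of x] gdev[of x] g'a by (intro exI[of _ "g' x"]) auto
    qed
    then show ?thesis by (simp add: ga)
  qed
  have l0: "0 < l" and u1: "u < 1" using win[of l] win[of u] lu by auto
  \<comment> \<open>The local estimate says nothing this far out; a sign change would yield a second
    zero by the intermediate value theorem, against uniqueness.\<close>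
  have left: "g x < 0" if x: "x \<in> {0..l}" for x
  proof (rule ccontr)
    assume "\<not> g x < 0"
    then obtain z where "x \<le> z" "z \<le> l" "g z = 0"
      using IVT2'[of g l 0 x] gl x continuous_on_subset[OF gcont, of "{x..l}"] lu u1 by auto
    then show False using uniq[of z] x lu u1 by auto
  qed
  have right: "0 < g x" if x: "x \<in> {u..1}" for x
  proof (rule ccontr)
    assume "\<not> 0 < g x"
    then obtain z where "u \<le> z" "z \<le> x" "g z = 0"
      using IVT2'[of g x 0 u] gu x continuous_on_subset[OF gcont, of "{u..x}"] lu l0 by auto
    then show False using uniq[of z] x lu l0 by auto
  qed
  \<comment> \<open>The entries secure, in turn, the lower bound
    \<open>2 * \<epsilon> \<le> m\<close>, the slope margin
    \<open>2 * \<epsilon> \<le> g' a / 4\<close> (from \<open>g' a / 2\<close> down to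
    \<open>s = g' a / 4\<close>, and from \<open>2 * g' a\<close> up to
    \<open>S = 3 * g' a\<close>), and distance below \<open>\<rho>\<close>.\<close>
  define \<epsilon> where "\<epsilon> = min (min (m / 2) (g' a / 8)) (\<rho> / 4)"
  have \<epsilon>: "0 < \<epsilon>" "2 * \<epsilon> \<le> m" "2 * \<epsilon> \<le> g' a / 4" "2 * \<epsilon> < \<rho>"
    using m g'a \<rho> by (auto simp: \<epsilon>_def)
  have "crossing_window f l u (g' a / 4) (3 * g' a) \<epsilon>"
  proof (rule crossing_window.intro)
    show "prob_space (density base_measure (\<lambda>x. ennreal (f x)))"
      using Pt P_eq by (simp add: P_tilde_def)
    show "2 * \<epsilon> \<le> f (x, y)" if "x \<in> {l..u}" "y \<in> {-1, 1}" for x y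
      using win[OF that(1)] that(2) \<epsilon> by auto
    show "g' a / 4 + 2 * \<epsilon> \<le> partial1 f (x, 1) - partial1 f (x, -1)" if "x \<in> {l..u}" for x
      using win[OF that] \<epsilon> unfolding g'_def[of x] by linarith
    show "partial1 f (x, 1) - partial1 f (x, -1) \<le> 3 * g' a - 2 * \<epsilon>" if "x \<in> {l..u}" for x
      using win[OF that] \<epsilon> g'a unfolding g'_def[of x] by linarith
    show "f (x, 1) < f (x, -1)" if "x \<in> {0..l}" for x
      using left[OF that] by (simp add: g_def)
    show "f (x, -1) < f (x, 1)" if "x \<in> {u..1}" for x
      using right[OF that] by (simp add: g_def)
  qed (use C1 nonneg l0 u1 lu g'a \<epsilon> in auto)
  then show ?thesis
    using that \<epsilon>(4) by (simp add: f_def)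
qed

theorem corollary1p5:
  fixes U :: "(real \<times> int) measure set"
  assumes "openin P_topology U" and "U \<noteq> {}"
  shows "\<exists>c3>0. \<forall>(\<beta> :: nat \<Rightarrow> real) (a_hat :: nat \<Rightarrow> (nat \<Rightarrow> real \<times> int) \<Rightarrow> real).
    (\<forall>n\<ge>1. \<beta> n > 0) \<longrightarrow>
    filterlim (\<lambda>n. real n powr (-1/3) * \<beta> n) at_top sequentially \<longrightarrow>
    (\<forall>n\<ge>1. estimator n (a_hat n)) \<longrightarrow>
    (SUP P\<in>U. limsup (\<lambda>n. ereal (measure (PiM {..<n} (\<lambda>_. P))
        {\<omega> \<in> space (PiM {..<n} (\<lambda>_. P)).
          prediction_error P (a_hat n \<omega>) > prediction_error P (crossing P) + c3 / (\<beta> n)\<^sup>2})))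
      \<ge> 1/4"
proof -
  interpret D: Metric_space P_tilde dist_P by (rule Metric_space_P_tilde)
  obtain V where V: "openin D.mtopology V" "U = V \<inter> P_class"
    using assms(1) by (auto simp: P_topology_def openin_subtopology)
  obtain P0 where P0: "P0 \<in> V" "P0 \<in> P_class"
    using assms(2) V by blast
  then have P0t: "P0 \<in> P_tilde" by (simp add: P_class_def)
  obtain \<rho> where \<rho>: "0 < \<rho>" "D.mball P0 \<rho> \<subseteq> V"
    using V(1) P0(1) unfolding D.openin_mtopology by blast
  obtain l u s S \<epsilon> where win: "crossing_window (dens P0) l u s S \<epsilon>" and \<epsilon>: "2 * \<epsilon> < \<rho>"
    using crossing_window_ex[OF P0(2) \<rho>(1)] by blast
  interpret W: crossing_window "dens P0" l u s S \<epsilon> by (rule win)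
  have in_U: "W.pmeas v \<in> U" if v: "v \<in> W.directions" for v
    using W.dist_P_pmeas[OF v P0t refl] W.pmeas_P_tilde[OF v] W.pmeas_P_class[OF v] P0t \<epsilon> \<rho>(2) V(2)
    by (auto simp: subset_iff)
  show ?thesis
  proof (rule exI[of _ 1], intro conjI allI impI)
    fix \<beta> :: "nat \<Rightarrow> real" and a_hat :: "nat \<Rightarrow> (nat \<Rightarrow> real \<times> int) \<Rightarrow> real"
    assume lim: "filterlim (\<lambda>n. real n powr (-1/3) * \<beta> n) at_top sequentially"
      and est: "\<forall>n\<ge>1. estimator n (a_hat n)"
    let ?p = "\<lambda>P n. measure (PiM {..<n} (\<lambda>_. P)) {\<omega> \<in> space (PiM {..<n} (\<lambda>_. P)).
          prediction_error P (a_hat n \<omega>) > prediction_error P (crossing P) + 1 / (\<beta> n)\<^sup>2}"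
    \<comment> \<open>The perturbation may depend on \<open>\<beta>\<close> and the estimators,
      since the supremum over \<open>U\<close> is taken after these are fixed.\<close>
    obtain v where v: "v \<in> W.directions"
      "\<And>N. \<exists>n\<ge>N. 1 / 4 \<le> W.failure v n (a_hat n) (1 / (\<beta> n)\<^sup>2)"
      using W.failure_infinitely_often[OF lim, of a_hat] est by blast
    have eq: "W.failure v n (a_hat n) (1 / (\<beta> n)\<^sup>2) = ?p (W.pmeas v) n" for n
      by (simp add: W.failure_def W.excess_def less_diff_eq add.commute)
    \<comment> \<open>A failure beyond every \<open>N\<close> bounds each tail supremum from below,
      hence also their infimum.\<close>
    have "1 / 4 \<le> limsup (\<lambda>n. ereal (?p (W.pmeas v) n))"
      unfolding limsup_INF_SUP
    proof (rule INF_greatest)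
      fix N
      obtain n where n: "n \<ge> N" "1 / 4 \<le> ?p (W.pmeas v) n"
        using v(2)[of N] unfolding eq by blast
      have "1 / 4 \<le> ereal (?p (W.pmeas v) n)"
        using n(2) by (simp add: one_ereal_def numeral_eq_ereal)
      then show "1 / 4 \<le> (SUP n\<in>{N..}. ereal (?p (W.pmeas v) n))"
        by (rule SUP_upper2[rotated]) (use n in auto)
    qed
    then show "1 / 4 \<le> (SUP P\<in>U. limsup (\<lambda>n. ereal (?p P n)))"
      by (rule SUP_upper2[OF in_U[OF v(1)]])
  qed simp
qed

end
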